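(* Let $f\colon[0,1]\to[0,1]$ be a Manneville--Pomeau type map (as defined in the context). For every countable set $P\subset[0,1]$, the exceptional set $$\mathcal E_f(P)=\big\{x\in[0,1]\colon P\cap\overline{\{f^n(x)\colon n\ge 0\}}=\emptyset\big\}$$ is absolute winning in $[0,1]$.
   Context: **Manneville--Pomeau type map.** A two-branch interval map $f\colon[0,1]\to[0,1]$ for which there is $r_1\in(0,1)$ such that (using one-sided derivatives, i.e. derivatives of the one-sided branch extensions, as needed): (1) $f((0,r_1))=f((r_1,1))=(0,1)$; (2) $f$ is $C^1$ on $[0,r_1)$ and $C^2$ on $(0,r_1)\cup(r_1,1]$; (3) $f(0)=f(r_1)=0$, $f'(0)=1$, and $|f'|>1$ on $(0,1]$ (hence $\inf_{x\in[\epsilon,1]}|f'|>1$ for all $\epsilon>0$); (4) $\sup_{x\in[0,1]}|f'(x)|<\infty$ and $\sup_{x\in(r_1,1]}|f''(x)|<\infty$; (5) there exist $C\ge1$ and $\gamma>0$ such that $C^{-1}\le f''(x)/x^{\gamma-1}\le C$ for $x\in(0,r_1)$. The branch of $f$ on $(r_1,1]$ is monotone and may have either orientation. The value $f(r_1)=0$ is a convention. **Absolute game.** Let $I\subset\mathbb R$ be a nontrivial compact interval, $S\subset I$, and $0<\beta<1/3$. In the $\beta$-absolute game Bob chooses a nontrivial closed interval $B_1\subset I$. After Bob chooses $B_n$, Alice deletes a closed interval $A_n\subset B_n$ with $|A_n|\le\beta|B_n|$. Bob then chooses a closed interval $B_{n+1}\subset B_n\setminus A_n$ with $|B_{n+1}|\ge\beta|B_n|$.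 Alice wins if $\bigcap_n B_n$ meets $S$. The set $S$ is $\beta$-absolute winning in $I$ if Alice can win regardless of Bob's choices, and absolute winning in $I$ if it is $\beta$-absolute winning for every $0<\beta<1/3$. Here $|\cdot|$ denotes length. *)

theory Defs
  imports "HOL-Analysis.Analysis"
begin

section \<open>Manneville--Pomeau type maps\<close>

text \<open>
  The extensions of the two branches of \<open>f\<close> to the closed intervals \<open>[0,r]\<close> and \<open>[r,1]\<close>: the
  conventional value \<open>f r\<close> is replaced by the one-sided limit. If that limit does not
  exist, the value of \<^const>\<open>Lim\<close> is unspecified, but then the branch cannot be differentiable
  at \<open>r\<close>, as is demanded below.
\<close>

definition left_branch :: "(real \<Rightarrow> real) \<Rightarrow> real \<Rightarrow> real \<Rightarrow> real" where
  "left_branch f r = f(r := Lim (at_left r) f)"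

definition right_branch :: "(real \<Rightarrow> real) \<Rightarrow> real \<Rightarrow> real \<Rightarrow> real" where
  "right_branch f r = f(r := Lim (at_right r) f)"

text \<open>
  \<open>L'\<close>, \<open>L''\<close> and \<open>R'\<close>, \<open>R''\<close> are the first and second derivatives of the two branches, which
  the derivative clauses determine uniquely on the intervals where they are used. A condition on
  \<open>f'\<close> at the point \<open>r\<close> is a condition on both one-sided derivatives there. Their
  existence is no extra requirement, since the bounds on \<open>f''\<close> make \<open>f'\<close> converge at \<open>r\<close> from
  either side. That \<open>\<bar>R' r\<bar> > 1\<close> is what makes \<open>\<bar>f'\<bar>\<close> bounded away from 1 on \<open>[\<epsilon>,1]\<close>.
\<close>

definition manneville_pomeau :: "(real \<Rightarrow> real) \<Rightarrow> bool" where
  "manneville_pomeau f \<longleftrightarrow>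
     f ` {0..1} \<subseteq> {0..1} \<and>
     (\<exists>r\<in>{0<..<1}. \<exists>L' L'' R' R'' :: real \<Rightarrow> real.
        f ` {0<..<r} = {0<..<1} \<and> f ` {r<..<1} = {0<..<1} \<and>
        (\<forall>x\<in>{0..r}. (left_branch f r has_real_derivative L' x) (at x within {0..r})) \<and>
        (\<forall>x\<in>{r..1}. (right_branch f r has_real_derivative R' x) (at x within {r..1})) \<and>
        continuous_on {0..<r} L' \<and>
        (\<forall>x\<in>{0<..<r}. (L' has_real_derivative L'' x) (at x)) \<and>
        (\<forall>x\<in>{r<..1}. (R' has_real_derivative R'' x) (at x within {r<..1})) \<and>
        continuous_on {0<..<r} L'' \<and> continuous_on {r<..1} R'' \<and>
        f 0 = 0 \<and> f r = 0 \<and> L' 0 = 1 \<and>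
        (\<forall>x\<in>{0<..r}. \<bar>L' x\<bar> > 1) \<and> (\<forall>x\<in>{r..1}. \<bar>R' x\<bar> > 1) \<and>
        bdd_above ((\<lambda>x. \<bar>L' x\<bar>) ` {0..r}) \<and> bdd_above ((\<lambda>x. \<bar>R' x\<bar>) ` {r..1}) \<and>
        bdd_above ((\<lambda>x. \<bar>R'' x\<bar>) ` {r<..1}) \<and>
        (\<exists>C \<gamma>. C \<ge> 1 \<and> \<gamma> > 0 \<and>
           (\<forall>x\<in>{0<..<r}. inverse C \<le> L'' x / x powr (\<gamma> - 1) \<and> L'' x / x powr (\<gamma> - 1) \<le> C)))"

definition exceptional_set :: "(real \<Rightarrow> real) \<Rightarrow> real set \<Rightarrow> real set" where
  "exceptional_set f P = {x\<in>{0..1}. P \<inter> closure (range (\<lambda>n. (f ^^ n) x)) = {}}"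

section \<open>The absolute game\<close>

definition closed_interval :: "real set \<Rightarrow> bool" where
  "closed_interval J \<longleftrightarrow> (\<exists>a b. a \<le> b \<and> J = {a..b})"

definition nontrivial_closed_interval :: "real set \<Rightarrow> bool" where
  "nontrivial_closed_interval J \<longleftrightarrow> (\<exists>a b. a < b \<and> J = {a..b})"

abbreviation interval_length :: "real set \<Rightarrow> real" where
  "interval_length J \<equiv> measure lborel J"

definition legal_deletion :: "real \<Rightarrow> real set \<Rightarrow> real set \<Rightarrow> bool" where
  "legal_deletion \<beta> B A \<longleftrightarrow>
     closed_interval A \<and> A \<subseteq> B \<and> interval_length A \<le> \<beta> * interval_length B"

text \<open>
  A strategy of Alice maps the list of Bob's moves so far to the interval she deletes. It has to
  answer every position with a legal move, even one that does not arise in any play; otherwise a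
  strategy could win vacuously by deleting so much that Bob cannot continue.
\<close>

definition alice_strategy :: "real \<Rightarrow> (real set list \<Rightarrow> real set) \<Rightarrow> bool" where
  "alice_strategy \<beta> \<sigma> \<longleftrightarrow>
     (\<forall>Bs. Bs \<noteq> [] \<and> nontrivial_closed_interval (last Bs) \<longrightarrow> legal_deletion \<beta> (last Bs) (\<sigma> Bs))"

text \<open>Bob's moves are numbered from 0, so \<open>map B [0..<Suc n]\<close> is the history up to his move \<open>B n\<close>.\<close>

definition bob_play ::
    "real \<Rightarrow> real set \<Rightarrow> (real set list \<Rightarrow> real set) \<Rightarrow> (nat \<Rightarrow> real set) \<Rightarrow> bool" where
  "bob_play \<beta> I \<sigma> B \<longleftrightarrow>
     nontrivial_closed_interval (B 0) \<and> B 0 \<subseteq> I \<and>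
     (\<forall>n. closed_interval (B (Suc n)) \<and>
          B (Suc n) \<subseteq> B n - \<sigma> (map B [0..<Suc n]) \<and>
          interval_length (B (Suc n)) \<ge> \<beta> * interval_length (B n))"

definition beta_absolute_winning :: "real \<Rightarrow> real set \<Rightarrow> real set \<Rightarrow> bool" where
  "beta_absolute_winning \<beta> I S \<longleftrightarrow>
     S \<subseteq> I \<and>
     (\<exists>\<sigma>. alice_strategy \<beta> \<sigma> \<and> (\<forall>B. bob_play \<beta> I \<sigma> B \<longrightarrow> (\<Inter>n. B n) \<inter> S \<noteq> {}))"

definition absolute_winning :: "real set \<Rightarrow> real set \<Rightarrow> bool" where
  "absolute_winning I S \<longleftrightarrow> (\<forall>\<beta>. 0 < \<beta> \<and> \<beta> < 1/3 \<longrightarrow> beta_absolute_winning \<beta> I S)"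

end

theory Submission
  imports Defs "HOL-Computational_Algebra.Factorial_Ring"
begin

text \<open>
  The orbit closure of \<open>x\<close> misses a point \<open>p\<close> as soon as \<open>x\<close> keeps away from every preimage \<open>y\<close> of
  \<open>p\<close>, say \<open>f\<^sup>n y = p\<close>, by a fixed multiple of the natural size \<open>1 / \<bar>(f\<^sup>n)' y\<bar>\<close> of a neighbourhood
  of \<open>y\<close> that \<open>f\<^sup>n\<close> blows up to unit length. So Alice has countably many families of obstacles
  \<open>(y, \<rho>)\<close> to avoid, one for each point \<open>p\<close>. She can do so
  (\<open>absolute_winning_badly_approximable\<close>) provided that within each family two distinct obstacles of
  comparable size \<open>\<rho>\<close> are at least a fixed multiple of \<open>\<rho>\<close> apart: she serves family \<open>i\<close> on every
  \<open>2\<^bsup>i+1\<^esup>\<close>-th turn, Bob's interval shrinks by a bounded factor between two of these turns, and for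
  the sizes that belong to the present scale there is only one obstacle to delete.

  The separation of preimages (\<open>scale_separated_preimages\<close>) is a statement about cylinders, the
  intervals on which the first \<open>n\<close> iterates follow a fixed sequence of branches. A preimage \<open>y'\<close> of
  order \<open>n'\<close> sits well inside its cylinder, so another preimage \<open>y\<close> of order \<open>n \<le> n'\<close> can be close
  to it only when it lies in the same cylinder. Then \<open>f\<^bsup>n'\<^esup>\<close> carries \<open>y\<close> to \<open>f\<^bsup>k\<^esup> p\<close> with
  \<open>k = n' - n\<close>. Comparability of sizes bounds \<open>k\<close>, because cylinders shrink, and for bounded \<open>k\<close> the
  point \<open>f\<^bsup>k\<^esup> p\<close>, if it differs from \<open>p\<close>, is at a definite distance from it.

  All this needs bounded distortion of \<open>f\<^sup>n\<close> on its cylinders. The usual proof by uniform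
  expansion breaks down at the neutral fixed point 0. The remedy is to measure distances in
  the metric \<open>\<bar>g u - g v\<bar>\<close> with \<open>g t = ln t + K t\<close>. Convexity at the fixed point and expansion
  of the other branch show that \<open>f\<close> expands this metric, and that the surplus
  \<open>\<bar>g (f u) - g (f v)\<bar> - \<bar>g u - g v\<bar>\<close> dominates the variation of \<open>ln \<bar>f'\<bar>\<close> between \<open>u\<close> and \<open>v\<close>
  (\<open>tempered_distortion\<close>). Along an orbit these surpluses telescope, so the distortion of every
  iterate is controlled by \<open>\<bar>g (f\<^sup>n u) - g (f\<^sup>n v)\<bar>\<close> alone, which is bounded as long as the two end
  points stay away from 0.

  The ends 0 and 1 need no obstacles of their own: an orbit gets closer to them than it started
  only after coming equally close to the branch point \<open>r\<close> (\<open>orbit_away_from_ends\<close>), so it suffices to add \<open>r\<close> to the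
  points to be avoided.
\<close>

section \<open>Obstacles of different sizes in the absolute game\<close>

text \<open>
  A pair \<open>(y, \<rho>)\<close> is an obstacle of size \<open>\<rho>\<close> at the point \<open>y\<close>. Only obstacles of comparable size
  have to be apart, since a single turn of Alice deals with one range of sizes.
\<close>

definition scale_separated :: "(real \<times> real) set \<Rightarrow> bool" where
  "scale_separated F \<longleftrightarrow>
     (\<forall>N. \<exists>\<delta>>0. \<forall>(y, \<rho>)\<in>F. \<forall>(y', \<rho>')\<in>F.
        0 < \<rho> \<and> \<rho> \<le> \<rho>' \<and> \<rho>' \<le> N * \<rho> \<and> \<bar>y - y'\<bar> \<le> \<delta> * \<rho> \<longrightarrow> y = y')"

text \<open>
  With obstacles \<open>p / q\<close> of size \<open>1 / q\<^sup>2\<close> the irrational members of this set are the badly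
  approximable numbers. Obstacles above some size are disregarded because Bob's interval may be too
  short compared with them already when Alice first attends to the family.
\<close>

definition badly_approximable :: "(real \<times> real) set \<Rightarrow> real set" where
  "badly_approximable F =
     {x. \<exists>\<epsilon>>0. \<forall>(y, \<rho>)\<in>F. 0 < \<rho> \<and> \<rho> \<le> \<epsilon> \<longrightarrow> \<epsilon> * \<rho> \<le> \<bar>x - y\<bar>}"

text \<open>
  Alice serves family \<open>i\<close> on her turns number \<open>2\<^sup>i (2k + 1)\<close>, counted from 1. Thus every turn serves
  one family and consecutive turns for family \<open>i\<close> are \<open>2\<^bsup>i+1\<^esup>\<close> apart.
\<close>

lemma dyadic_odd_part_unique:
  assumes "2 ^ i * (2 * k + 1) = 2 ^ i' * (2 * k' + 1 :: nat)"
  shows "i = i'"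
proof -
  have "multiplicity 2 (2 ^ j * (2 * m + 1)) = j" for j and m :: nat
  proof (rule multiplicity_eqI)
    have "\<not> 2 ^ j * 2 dvd 2 ^ j * (2 * m + 1)" by (subst nat_mult_dvd_cancel1) auto
    then show "\<not> 2 ^ Suc j dvd 2 ^ j * (2 * m + 1)" by (simp only: power_Suc2 not_False_eq_True)
  qed simp
  then show ?thesis using assms by metis
qed

text \<open>
  The requirements on the deletion \<open>A\<close> on turn \<open>n\<close>, where \<open>\<delta> i\<close> is the separation constant of
  family \<open>i\<close>. The ratio of the ends of the window of sizes \<open>\<rho>\<close> is \<open>\<beta>\<close> to the power \<open>2\<^bsup>i+1\<^esup>\<close>. This
  is the most that Bob can shrink his interval before the next turn for the same family, so that
  the windows of these turns leave no gap. The length of \<open>A\<close> is prescribed exactly in order to force Bob's intervals to shrink to a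
  point.
\<close>

definition answers ::
    "real \<Rightarrow> (nat \<Rightarrow> (real \<times> real) set) \<Rightarrow> (nat \<Rightarrow> real) \<Rightarrow> nat \<Rightarrow> real set \<Rightarrow> real set \<Rightarrow> bool" where
  "answers \<beta> F \<delta> n B A \<longleftrightarrow>
     legal_deletion \<beta> B A \<and> interval_length A = \<beta> * interval_length B \<and>
     (\<forall>i k. Suc n = 2 ^ i * (2 * k + 1) \<longrightarrow>
        (\<forall>(y, \<rho>)\<in>F i. 0 < \<rho> \<and> \<beta> ^ 2 ^ Suc i * (\<delta> i * \<rho>) < 2 * interval_length B \<and>
             2 * interval_length B \<le> \<delta> i * \<rho> \<longrightarrow>
           (\<forall>x\<in>B. \<bar>x - y\<bar> \<le> \<beta> * interval_length B / 2 \<longrightarrow> x \<in> A)))"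

lemma deletion_around_point:
  fixes a b y \<beta> :: real
  assumes "a < b" "0 < \<beta>" "\<beta> < 1"
  shows "\<exists>A. legal_deletion \<beta> {a..b} A \<and> interval_length A = \<beta> * interval_length {a..b} \<and>
             (\<forall>x\<in>{a..b}. \<bar>x - y\<bar> \<le> \<beta> * interval_length {a..b} / 2 \<longrightarrow> x \<in> A)"
proof -
  define m where "m = \<beta> * (b - a)"
  have m: "0 < m" "m < b - a" using assms by (auto simp: m_def)
  define c where "c = max a (min (y - m / 2) (b - m))"
  have c: "a \<le> c" "c + m \<le> b" using m by (auto simp: c_def)
  have "x \<in> {c..c + m}" if "x \<in> {a..b}" "\<bar>x - y\<bar> \<le> m / 2" for x
    using that m by (auto simp: c_def max_def min_def abs_if split: if_splits)
  then show ?thesis using c m assms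
    by (intro exI[of _ "{c..c + m}"])
       (auto simp: legal_deletion_def closed_interval_def m_def)
qed

text \<open>
  Two obstacles in the window of a turn whose neighbourhoods both meet Bob's interval are at most
  two lengths of that interval apart, so they coincide by separation, and one deletion is enough.
\<close>

lemma answer_exists:
  assumes \<beta>: "0 < \<beta>" "\<beta> < 1" and B: "nontrivial_closed_interval B"
    and \<delta>: "\<And>i. 0 < \<delta> i"
    and sep: "\<And>i y \<rho> y' \<rho>'. (y, \<rho>) \<in> F i \<Longrightarrow> (y', \<rho>') \<in> F i \<Longrightarrow> 0 < \<rho> \<Longrightarrow> \<rho> \<le> \<rho>' \<Longrightarrow>
               \<rho>' \<le> inverse (\<beta> ^ 2 ^ Suc i) * \<rho> \<Longrightarrow> \<bar>y - y'\<bar> \<le> \<delta> i * \<rho> \<Longrightarrow> y = y'"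
  shows "\<exists>A. answers \<beta> F \<delta> n B A"
proof -
  obtain a b where ab: "a < b" "B = {a..b}"
    using B by (auto simp: nontrivial_closed_interval_def)
  define w where "w = b - a"
  have w: "0 < w" "interval_length B = w" using ab by (auto simp: w_def)
  define active where "active = (\<lambda>i y \<rho>. (y, \<rho>) \<in> F i \<and> 0 < \<rho> \<and>
      \<beta> ^ 2 ^ Suc i * (\<delta> i * \<rho>) < 2 * w \<and> 2 * w \<le> \<delta> i * \<rho> \<and> (\<exists>x\<in>B. \<bar>x - y\<bar> \<le> \<beta> * w / 2))"
  have le: "y = y'" if act: "active i y \<rho>" "active i y' \<rho>'" and "\<rho> \<le> \<rho>'" for i y \<rho> y' \<rho>'
  proof (rule sep[of y \<rho> i y' \<rho>'])
    obtain x x' where x: "x \<in> B" "\<bar>x - y\<bar> \<le> \<beta> * w / 2" "x' \<in> B" "\<bar>x' - y'\<bar> \<le> \<beta> * w / 2"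
      using act by (auto simp: active_def)
    have "\<beta> * w \<le> w" using \<beta> w by simp
    moreover have "\<bar>x - x'\<bar> \<le> w" using x ab by (auto simp: w_def)
    ultimately have "\<bar>y - y'\<bar> \<le> 2 * w" using x by linarith
    then show "\<bar>y - y'\<bar> \<le> \<delta> i * \<rho>" using act by (auto simp: active_def)
    have "\<beta> ^ 2 ^ Suc i * (\<delta> i * \<rho>') \<le> \<delta> i * \<rho>" using act by (auto simp: active_def)
    then have "\<delta> i * (\<beta> ^ 2 ^ Suc i * \<rho>') \<le> \<delta> i * \<rho>" by (simp add: mult_ac)
    then have "\<beta> ^ 2 ^ Suc i * \<rho>' \<le> \<rho>" using \<delta>[of i] by (simp only: mult_le_cancel_left_pos)
    moreover have "0 < \<beta> ^ 2 ^ Suc i" using \<beta> by simp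
    ultimately show "\<rho>' \<le> inverse (\<beta> ^ 2 ^ Suc i) * \<rho>"
      by (simp only: pos_le_divide_eq[symmetric] divide_inverse mult.commute)
  qed (use that in \<open>auto simp: active_def\<close>)
  then have unique: "y = y'" if "active i y \<rho>" "active i y' \<rho>'" for i y \<rho> y' \<rho>'
    using that by (metis linear)
  obtain z where z: "\<And>i k y \<rho>. Suc n = 2 ^ i * (2 * k + 1) \<Longrightarrow> active i y \<rho> \<Longrightarrow> y = z"
    by (metis dyadic_odd_part_unique unique)
  obtain A where "legal_deletion \<beta> B A" "interval_length A = \<beta> * interval_length B"
      "\<forall>x\<in>B. \<bar>x - z\<bar> \<le> \<beta> * interval_length B / 2 \<longrightarrow> x \<in> A"
    using deletion_around_point[of a b \<beta> z] ab \<beta> by auto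
  then have "answers \<beta> F \<delta> n B A"
    using z unfolding answers_def active_def w(2) by blast
  then show ?thesis ..
qed

lemma interval_disjoint_from_deletion_shorter:
  fixes a b c d a' b' :: real
  assumes "{c..d} \<subseteq> {a..b}" "c \<le> d" "a' \<le> b'" "{a'..b'} \<subseteq> {a..b} - {c..d}"
  shows "b' - a' \<le> (b - a) - (d - c)"
proof -
  have "max a' c \<notin> {a'..b'} \<inter> {c..d}" using assms by blast
  then have "b' < c \<or> d < a'" using assms by (auto simp: max_def split: if_splits)
  then show ?thesis using assms by auto
qed

lemma bob_play_intervals:
  assumes \<beta>: "0 < \<beta>" and \<sigma>: "alice_strategy \<beta> \<sigma>"
    and exact: "\<And>Bs. Bs \<noteq> [] \<Longrightarrow> nontrivial_closed_interval (last Bs) \<Longrightarrow>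
            interval_length (\<sigma> Bs) = \<beta> * interval_length (last Bs)"
    and play: "bob_play \<beta> I \<sigma> B"
  shows "nontrivial_closed_interval (B n)"
    and "\<beta> * interval_length (B n) \<le> interval_length (B (Suc n))"
    and "interval_length (B (Suc n)) \<le> (1 - \<beta>) * interval_length (B n)"
proof -
  have step: "nontrivial_closed_interval (B (Suc n)) \<and>
      interval_length (B (Suc n)) \<le> (1 - \<beta>) * interval_length (B n)"
    if n: "nontrivial_closed_interval (B n)" for n
  proof -
    have \<open>legal_deletion \<beta> (B n) (\<sigma> (map B [0..<Suc n]))\<close>
         "interval_length (\<sigma> (map B [0..<Suc n])) = \<beta> * interval_length (B n)"
      using \<sigma> exact[of "map B [0..<Suc n]"] n by (auto simp: alice_strategy_def)
    then obtain c d where cd: "c \<le> d" "\<sigma> (map B [0..<Suc n]) = {c..d}" "{c..d} \<subseteq> B n"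
        "d - c = \<beta> * interval_length (B n)"
      by (auto simp: legal_deletion_def closed_interval_def)
    obtain a b where ab: "a < b" "B n = {a..b}" using n by (auto simp: nontrivial_closed_interval_def)
    have "closed_interval (B (Suc n))" using play by (auto simp: bob_play_def)
    then obtain a' b' where ab': "a' \<le> b'" "B (Suc n) = {a'..b'}"
      by (auto simp: closed_interval_def)
    have "\<beta> * interval_length (B n) \<le> interval_length (B (Suc n))"
         "B (Suc n) \<subseteq> B n - \<sigma> (map B [0..<Suc n])"
      using play unfolding bob_play_def by blast+
    moreover from this have "b' - a' \<le> (b - a) - (d - c)"
      using interval_disjoint_from_deletion_shorter[of c d a b a' b'] ab ab' cd by auto
    moreover have "0 < \<beta> * (b - a)" using \<beta> ab by simp
    ultimately show ?thesis using ab ab' cd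
      by (auto simp: nontrivial_closed_interval_def algebra_simps intro!: exI[of _ a'] exI[of _ b'])
  qed
  show nt: "nontrivial_closed_interval (B n)" for n
    using step play by (induction n) (auto simp: bob_play_def)
  show "interval_length (B (Suc n)) \<le> (1 - \<beta>) * interval_length (B n)" using step nt by blast
  show "\<beta> * interval_length (B n) \<le> interval_length (B (Suc n))"
    using play by (auto simp: bob_play_def)
qed

text \<open>
  The point in which Bob's intervals intersect survives all deletions. A small obstacle in family
  \<open>i\<close> falls into the window of the first turn for that family at which Bob's interval is short
  compared with it, and the deletion on this turn keeps the point away from it.
\<close>

lemma beta_absolute_winning_badly_approximable:
  fixes F :: "nat \<Rightarrow> (real \<times> real) set"
  assumes \<beta>: "0 < \<beta>" "\<beta> < 1" and sep: "\<And>i. scale_separated (F i)"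
    and S: "S \<subseteq> I" "I \<inter> (\<Inter>i. badly_approximable (F i)) \<subseteq> S"
  shows "beta_absolute_winning \<beta> I S"
proof -
  have "\<exists>\<delta>. \<forall>i. 0 < \<delta> i \<and> (\<forall>(y, \<rho>)\<in>F i. \<forall>(y', \<rho>')\<in>F i.
          0 < \<rho> \<and> \<rho> \<le> \<rho>' \<and> \<rho>' \<le> inverse (\<beta> ^ 2 ^ Suc i) * \<rho> \<and> \<bar>y - y'\<bar> \<le> \<delta> i * \<rho> \<longrightarrow> y = y')"
    by (rule choice) (use sep in \<open>auto simp only: scale_separated_def\<close>)
  then obtain \<delta> where \<delta>: "\<And>i. 0 < \<delta> i" and \<delta>sep: "\<And>i. \<forall>(y, \<rho>)\<in>F i. \<forall>(y', \<rho>')\<in>F i.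
        0 < \<rho> \<and> \<rho> \<le> \<rho>' \<and> \<rho>' \<le> inverse (\<beta> ^ 2 ^ Suc i) * \<rho> \<and> \<bar>y - y'\<bar> \<le> \<delta> i * \<rho> \<longrightarrow> y = y'"
    by blast
  define \<sigma> where "\<sigma> Bs = (SOME A. answers \<beta> F \<delta> (length Bs - 1) (last Bs) A)" for Bs
  have \<sigma>: "answers \<beta> F \<delta> (length Bs - 1) (last Bs) (\<sigma> Bs)"
    if "nontrivial_closed_interval (last Bs)" for Bs
    unfolding \<sigma>_def
    by (rule someI_ex, rule answer_exists[OF \<beta> that \<delta>]) (use \<delta>sep in blast)
  have alice: "alice_strategy \<beta> \<sigma>"
    using \<sigma> by (auto simp: alice_strategy_def answers_def)
  have "(\<Inter>n. B n) \<inter> S \<noteq> {}" if play: "bob_play \<beta> I \<sigma> B" for B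
  proof -
    define w where "w n = interval_length (B n)" for n
    note B = bob_play_intervals[OF \<beta>(1) alice _ play]
    have exact: "interval_length (\<sigma> Bs) = \<beta> * interval_length (last Bs)"
      if "nontrivial_closed_interval (last Bs)" for Bs
      using \<sigma>[OF that] by (simp add: answers_def)
    have nt: "nontrivial_closed_interval (B n)" for n using B(1)[OF exact] .
    have lo: "\<beta> * w n \<le> w (Suc n)" for n unfolding w_def using B(2)[OF exact] .
    have hi: "w (Suc n) \<le> (1 - \<beta>) * w n" for n unfolding w_def using B(3)[OF exact] .
    have w_pos: "0 < w n" for n
      using nt[of n] by (auto simp: w_def nontrivial_closed_interval_def)
    have sub: "B (Suc n) \<subseteq> B n - \<sigma> (map B [0..<Suc n])" for n
      using play by (auto simp: bob_play_def)
    have ans: "answers \<beta> F \<delta> n (B n) (\<sigma> (map B [0..<Suc n]))" for n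
      using \<sigma>[of "map B [0..<Suc n]"] nt[of n] by simp
    have lo_iter: "\<beta> ^ j * w n \<le> w (n + j)" for j n
    proof (induction j)
      case (Suc j)
      have "\<beta> ^ Suc j * w n = \<beta> * (\<beta> ^ j * w n)" by simp
      also have "\<dots> \<le> \<beta> * w (n + j)" using Suc \<beta> by simp
      finally show ?case using lo[of "n + j"] by simp
    qed simp
    have w_small: "\<exists>n\<ge>m. w n < e" if e: "0 < e" for e m
    proof -
      have hi_iter: "w n \<le> (1 - \<beta>) ^ n * w 0" for n
      proof (induction n)
        case (Suc n)
        have "(1 - \<beta>) * w n \<le> (1 - \<beta>) * ((1 - \<beta>) ^ n * w 0)" using Suc \<beta> by simp
        then show ?case using hi[of n] by simp
      qed simp
      have "(\<lambda>n. (1 - \<beta>) ^ n * w 0) \<longlonglongrightarrow> 0 * w 0"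
        by (intro tendsto_mult LIMSEQ_power_zero tendsto_const) (use \<beta> in auto)
      then have "\<forall>\<^sub>F n in sequentially. (1 - \<beta>) ^ n * w 0 < e" using e by (auto dest: order_tendstoD)
      then obtain n0 where "\<And>n. n \<ge> n0 \<Longrightarrow> (1 - \<beta>) ^ n * w 0 < e"
        by (auto simp: eventually_sequentially)
      then have "w (max m n0) < e" using hi_iter[of "max m n0"] by (meson le_less_trans max.cobounded2)
      then show ?thesis by (intro exI[of _ "max m n0"]) auto
    qed
    have dec: "B n \<subseteq> B m" if "m \<le> n" for m n
      using that sub by (induction n rule: dec_induct) auto
    have "(\<Inter>n. B n) \<noteq> {}"
    proof (rule compact_nest)
      show "compact (B n)" "B n \<noteq> {}" for n
        using nt[of n] by (auto simp: nontrivial_closed_interval_def)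
    qed (rule dec)
    then obtain x where x: "\<And>n. x \<in> B n" by auto
    have "x \<in> badly_approximable (F i)" for i
    proof -
      define t where "t k = 2 ^ i * (2 * k + 1) - (1::nat)" for k
      have t: "Suc (t k) = 2 ^ i * (2 * k + 1)" for k by (simp add: t_def)
      have t_step: "t (Suc k) = t k + 2 ^ Suc i" for k
      proof -
        have "Suc (t (Suc k)) = Suc (t k) + 2 ^ Suc i" unfolding t by (simp add: algebra_simps)
        then show ?thesis by simp
      qed
      have t_ge: "k \<le> t k" for k
      proof (induction k)
        case (Suc k)
        have "(1::nat) \<le> 2 ^ Suc i" by (rule one_le_power) simp
        then show ?case using Suc t_step[of k] by linarith
      qed simp
      \<comment> \<open>The second term excludes the obstacles that are too big for the first turn of the family.\<close>
      define \<epsilon> where "\<epsilon> = min (\<beta> * \<beta> ^ 2 ^ Suc i * \<delta> i / 4) (w (t 0) / \<delta> i)"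
      have "0 < \<epsilon>" using \<beta> \<delta>[of i] w_pos by (auto simp: \<epsilon>_def)
      moreover have "\<epsilon> * \<rho> \<le> \<bar>x - y\<bar>" if y: "(y, \<rho>) \<in> F i" "0 < \<rho>" "\<rho> \<le> \<epsilon>" for y \<rho>
      proof (rule ccontr)
        assume close: "\<not> \<epsilon> * \<rho> \<le> \<bar>x - y\<bar>"
        have pos: "0 < \<delta> i * \<rho> / 2" using \<delta>[of i] y by simp
        have ex: "\<exists>k. 2 * w (t k) \<le> \<delta> i * \<rho>"
        proof -
          obtain n where n: "w n < \<delta> i * \<rho> / 2" using w_small[OF pos] by blast
          have "w (t n) \<le> w n"
          proof -
            have "w (n + j) \<le> w n" for j
            proof (induction j)
              case (Suc j)
              have "(1 - \<beta>) * w (n + j) \<le> 1 * w (n + j)"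
                by (intro mult_right_mono) (use \<beta> w_pos[of "n + j"] in auto)
              then show ?case using Suc hi[of "n + j"] by simp
            qed simp
            then show ?thesis using t_ge[of n] by (metis le_add_diff_inverse)
          qed
          then show ?thesis using n by (intro exI[of _ n]) simp
        qed
        \<comment> \<open>The turn \<open>t k\<close> is the first one for this family that is late enough for the obstacle.\<close>
        define k where "k = (LEAST k. 2 * w (t k) \<le> \<delta> i * \<rho>)"
        have k: "2 * w (t k) \<le> \<delta> i * \<rho>" unfolding k_def by (rule LeastI_ex[OF ex])
        have least: "\<delta> i * \<rho> < 2 * w (t k')" if "k' < k" for k'
          using not_less_Least[of k' "\<lambda>k. 2 * w (t k) \<le> \<delta> i * \<rho>"] that by (simp add: k_def)
        have "\<rho> \<le> w (t 0) / \<delta> i" using y by (simp add: \<epsilon>_def)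
        then have "\<rho> * \<delta> i \<le> w (t 0)" using \<delta>[of i] by (simp add: pos_le_divide_eq)
        then have "k \<noteq> 0" using k w_pos[of "t 0"] by (cases "k = 0") (auto simp: mult.commute)
        then obtain k' where k': "k = Suc k'" by (cases k) auto
        have "\<beta> ^ 2 ^ Suc i * (\<delta> i * \<rho>) < \<beta> ^ 2 ^ Suc i * (2 * w (t k'))"
          using least[of k'] \<beta> k' by simp
        also have "\<dots> \<le> 2 * w (t k)"
          using lo_iter[of "2 ^ Suc i" "t k'"] by (simp add: t_step k')
        finally have scale: "\<beta> ^ 2 ^ Suc i * (\<delta> i * \<rho>) < 2 * w (t k)" .
        have "\<epsilon> * \<rho> \<le> (\<beta> * \<beta> ^ 2 ^ Suc i * \<delta> i / 4) * \<rho>"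
          using y(2) unfolding \<epsilon>_def by (intro mult_right_mono min.cobounded1) simp
        also have "\<dots> = \<beta> * (\<beta> ^ 2 ^ Suc i * (\<delta> i * \<rho>)) / 4" by simp
        also have "\<dots> \<le> \<beta> * (2 * w (t k)) / 4" using scale \<beta>
          by (intro divide_right_mono mult_left_mono) auto
        finally have "\<bar>x - y\<bar> \<le> \<beta> * w (t k) / 2" using close by simp
        moreover have "x \<in> B (t k)" by (rule x)
        ultimately have "x \<in> \<sigma> (map B [0..<Suc (t k)])"
          using ans[of "t k"] t[of k] y scale k unfolding answers_def w_def by blast
        then show False using sub[of "t k"] x[of "Suc (t k)"] by blast
      qed
      ultimately show ?thesis unfolding badly_approximable_def by blast
    qed
    moreover have "x \<in> I" using x[of 0] play by (auto simp: bob_play_def)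
    ultimately show ?thesis using S x by blast
  qed
  then show ?thesis unfolding beta_absolute_winning_def using alice S by blast
qed

lemma absolute_winning_badly_approximable:
  assumes "countable \<F>" and "\<And>F. F \<in> \<F> \<Longrightarrow> scale_separated F"
    and S: "S \<subseteq> I" "\<And>x. x \<in> I \<Longrightarrow> (\<And>F. F \<in> \<F> \<Longrightarrow> x \<in> badly_approximable F) \<Longrightarrow> x \<in> S"
  shows "absolute_winning I S"
proof -
  define F where "F = from_nat_into (insert {} \<F>)"
  have range: "range F = insert {} \<F>"
    unfolding F_def using assms by (intro range_from_nat_into) auto
  have "scale_separated {}" by (auto simp: scale_separated_def intro: exI[of _ 1])
  then have sep: "scale_separated (F i)" for i
    using assms(2) range by (metis insert_iff rangeI)
  have "I \<inter> (\<Inter>i. badly_approximable (F i)) \<subseteq> S"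
  proof
    fix x assume x: "x \<in> I \<inter> (\<Inter>i. badly_approximable (F i))"
    show "x \<in> S"
    proof (rule S(2))
      show "x \<in> badly_approximable G" if "G \<in> \<F>" for G
      proof -
        have "G \<in> range F" using that range by simp
        then show ?thesis using x by blast
      qed
    qed (use x in blast)
  qed
  then show ?thesis unfolding absolute_winning_def
    using beta_absolute_winning_badly_approximable[where F = F, OF _ _ sep S(1)] by auto
qed

text \<open>
  A family that places obstacles of all sizes at one point makes Alice avoid this point.
\<close>

lemma scale_separated_point: "scale_separated ({y} \<times> {0<..})"
  by (auto simp: scale_separated_def intro: exI[of _ 1])

lemma badly_approximable_point: "x \<in> badly_approximable ({y} \<times> {0<..}) \<Longrightarrow> x \<noteq> y"
  by (force simp: badly_approximable_def mult_le_0_iff)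

section \<open>Full-branch maps with telescoping distortion\<close>

lemma finite_positive_lower_bound:
  fixes \<phi> :: "nat \<Rightarrow> real"
  assumes "\<And>k. k < n \<Longrightarrow> P k \<Longrightarrow> 0 < \<phi> k"
  shows "\<exists>\<delta>>0. \<forall>k<n. P k \<longrightarrow> \<delta> \<le> \<phi> k"
  using assms
proof (induction n)
  case 0
  show ?case by (auto intro: exI[of _ 1])
next
  case (Suc n)
  then obtain \<delta> where \<delta>: "0 < \<delta>" "\<forall>k<n. P k \<longrightarrow> \<delta> \<le> \<phi> k" by auto
  show ?case
    by (rule exI[of _ "if P n then min \<delta> (\<phi> n) else \<delta>"])
       (use \<delta> Suc.prems in \<open>auto simp: less_Suc_eq\<close>)
qed

definition same_branch :: "real \<Rightarrow> real \<Rightarrow> real \<Rightarrow> bool" where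
  "same_branch r u v \<longleftrightarrow> (u \<in> {0<..<r} \<and> v \<in> {0<..<r}) \<or> (u \<in> {r<..<1} \<and> v \<in> {r<..<1})"

text \<open>
  The function \<open>l\<close> stands for \<open>ln \<bar>f'\<bar>\<close> and \<open>g\<close> for the coordinate whose metric \<open>f\<close> expands. The
  assumption \<open>distortion\<close> compares a difference quotient with the derivative at an end point, instead
  of two derivatives with each other: in this form it iterates without any chain rule, and its right
  hand side telescopes.
\<close>

locale full_branch_map =
  fixes f :: "real \<Rightarrow> real" and r :: real and l g :: "real \<Rightarrow> real" and A :: real
  assumes r: "0 < r" "r < 1"
    and onto_left: "f ` {0<..<r} = {0<..<1}"
    and onto_right: "f ` {r<..<1} = {0<..<1}"
    and between: "same_branch r u v \<Longrightarrow> w \<in> closed_segment u v \<Longrightarrow> f w \<in> closed_segment (f u) (f v)"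
    and expand: "same_branch r u v \<Longrightarrow> \<bar>u - v\<bar> \<le> \<bar>f u - f v\<bar>"
    and expand_uniformly: "0 < \<kappa> \<Longrightarrow>
          \<exists>\<mu>>1. \<forall>u v. same_branch r u v \<and> \<kappa> \<le> \<bar>u - v\<bar> \<longrightarrow> \<mu> * \<bar>u - v\<bar> \<le> \<bar>f u - f v\<bar>"
    and g_mono: "mono_on {0<..1} g"
    and A: "0 \<le> A"
    and distortion: "same_branch r u v \<Longrightarrow> u \<noteq> v \<Longrightarrow>
          \<bar>ln \<bar>f u - f v\<bar> - ln \<bar>u - v\<bar> - l v\<bar> \<le> A * (\<bar>g (f u) - g (f v)\<bar> - \<bar>g u - g v\<bar>)"
begin

text \<open>
  The points \<open>v\<close> with \<open>same_itinerary n u v\<close> form the \<open>n\<close>-cylinder of \<open>u\<close>. In particular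
  \<open>same_itinerary n u u\<close> says that \<open>u\<close> stays inside the two open branches for \<open>n\<close> steps.
\<close>

definition same_itinerary :: "nat \<Rightarrow> real \<Rightarrow> real \<Rightarrow> bool" where
  "same_itinerary n u v \<longleftrightarrow> (\<forall>i<n. same_branch r ((f ^^ i) u) ((f ^^ i) v))"

definition birkhoff_sum :: "nat \<Rightarrow> real \<Rightarrow> real" where
  "birkhoff_sum n v = (\<Sum>i<n. l ((f ^^ i) v))"

lemma same_itinerary_0 [simp]: "same_itinerary 0 u v" by (simp add: same_itinerary_def)

lemma same_itinerary_Suc: "same_itinerary (Suc n) u v \<longleftrightarrow> same_itinerary n u v \<and> same_branch r ((f ^^ n) u) ((f ^^ n) v)"
  by (auto simp: same_itinerary_def less_Suc_eq)

lemma same_itinerary_add: "same_itinerary (n + k) u v \<longleftrightarrow> same_itinerary n u v \<and> same_itinerary k ((f ^^ n) u) ((f ^^ n) v)"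
  by (induction k) (auto simp: same_itinerary_Suc funpow_add add.commute[of n])

lemma birkhoff_sum_add: "birkhoff_sum (n + k) u = birkhoff_sum n u + birkhoff_sum k ((f ^^ n) u)"
  by (induction k) (auto simp: birkhoff_sum_def funpow_add add.commute[of n])

lemma same_itinerary_sym: "same_itinerary n u v \<Longrightarrow> same_itinerary n v u"
  by (auto simp: same_itinerary_def same_branch_def)

lemma same_branch_trans: "same_branch r u v \<Longrightarrow> same_branch r v w \<Longrightarrow> same_branch r u w"
  by (auto simp: same_branch_def)

lemma same_itinerary_trans: "same_itinerary n u v \<Longrightarrow> same_itinerary n v w \<Longrightarrow> same_itinerary n u w"
  using same_branch_trans unfolding same_itinerary_def by blast

lemma same_branch_range: "same_branch r u v \<Longrightarrow> f u \<in> {0<..<1}"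
  unfolding same_branch_def using onto_left onto_right by blast

lemma orbit_in_unit: "same_itinerary n u v \<Longrightarrow> u \<in> {0<..<1} \<Longrightarrow> (f ^^ n) u \<in> {0<..<1}"
  by (cases n) (auto simp: same_itinerary_Suc dest: same_branch_range)

lemma orbit_in_unit': "same_itinerary n u v \<Longrightarrow> 0 < n \<Longrightarrow> (f ^^ n) u \<in> {0<..<1}"
  by (cases n) (auto simp: same_itinerary_Suc dest: same_branch_range)

text \<open>
  Every cylinder of order \<open>n\<close> is mapped onto the whole open unit interval by the \<open>n\<close>-th iterate.
\<close>

lemma branch_onto: "same_itinerary n x x \<Longrightarrow> t \<in> {0<..<1} \<Longrightarrow> \<exists>y. same_itinerary n x y \<and> (f ^^ n) y = t"
proof (induction n arbitrary: t)
  case (Suc n)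
  have "\<exists>s. same_branch r ((f ^^ n) x) s \<and> f s = t"
  proof (cases "(f ^^ n) x \<in> {0<..<r}")
    case True
    then show ?thesis using Suc.prems(2) onto_left[symmetric] by (auto simp: same_branch_def)
  next
    case False
    then have "(f ^^ n) x \<in> {r<..<1}" using Suc.prems(1) by (auto simp: same_itinerary_Suc same_branch_def)
    then show ?thesis using Suc.prems(2) onto_right[symmetric] by (auto simp: same_branch_def)
  qed
  then obtain s where s: "same_branch r ((f ^^ n) x) s" "f s = t" by blast
  then have "s \<in> {0<..<1}" using r by (auto simp: same_branch_def)
  then show ?case using Suc s by (auto simp: same_itinerary_Suc)
qed auto

lemma same_itinerary_between:
  "same_itinerary n u v \<Longrightarrow> w \<in> closed_segment u v \<Longrightarrow>
     same_itinerary n u w \<and> (f ^^ n) w \<in> closed_segment ((f ^^ n) u) ((f ^^ n) v)"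
proof (induction n)
  case (Suc n)
  then have *: "same_itinerary n u w" "(f ^^ n) w \<in> closed_segment ((f ^^ n) u) ((f ^^ n) v)"
      "same_branch r ((f ^^ n) u) ((f ^^ n) v)"
    by (auto simp: same_itinerary_Suc)
  then have "same_branch r ((f ^^ n) u) ((f ^^ n) w)"
    by (auto simp: same_branch_def closed_segment_eq_real_ivl split: if_splits)
  with * show ?case using between by (auto simp: same_itinerary_Suc)
qed auto

lemma iter_expand: "same_itinerary n u v \<Longrightarrow> \<bar>u - v\<bar> \<le> \<bar>(f ^^ n) u - (f ^^ n) v\<bar>"
proof (induction n)
  case (Suc n)
  then have "\<bar>u - v\<bar> \<le> \<bar>(f ^^ n) u - (f ^^ n) v\<bar>"
      "\<bar>(f ^^ n) u - (f ^^ n) v\<bar> \<le> \<bar>f ((f ^^ n) u) - f ((f ^^ n) v)\<bar>"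
    using expand by (auto simp: same_itinerary_Suc)
  then show ?case by simp
qed simp

lemma iter_inj: "same_itinerary n u v \<Longrightarrow> (f ^^ n) u = (f ^^ n) v \<Longrightarrow> u = v"
  using iter_expand[of n u v] by simp

text \<open>
  Bounded distortion: each step contributes the amount by which the \<open>g\<close>-distance grows, and the
  sum of these amounts is the total growth, however long the orbit lingers at the neutral point.
\<close>

lemma iter_distortion:
  assumes "same_itinerary n u v" "u \<noteq> v"
  shows "\<bar>ln \<bar>(f ^^ n) u - (f ^^ n) v\<bar> - ln \<bar>u - v\<bar> - birkhoff_sum n v\<bar>
           \<le> A * (\<bar>g ((f ^^ n) u) - g ((f ^^ n) v)\<bar> - \<bar>g u - g v\<bar>)"
  using assms(1)
proof (induction n)
  case (Suc n)
  let ?u = "(f ^^ n) u" and ?v = "(f ^^ n) v"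
  have *: "same_itinerary n u v" "same_branch r ?u ?v" using Suc.prems by (auto simp: same_itinerary_Suc)
  have "?u \<noteq> ?v" using iter_inj[OF *(1)] assms(2) by blast
  have telescope: "\<bar>c - a - (s + t)\<bar> \<le> A * (z - x)"
    if "\<bar>c - b - t\<bar> \<le> A * (z - y)" "\<bar>b - a - s\<bar> \<le> A * (y - x)" for a b c s t x y z
  proof -
    have "A * (z - x) = A * (z - y) + A * (y - x)" by (simp add: algebra_simps)
    with that show ?thesis by linarith
  qed
  show ?case
    using telescope[OF distortion[OF *(2) \<open>?u \<noteq> ?v\<close>] Suc.IH[OF *(1)]] by (simp add: birkhoff_sum_def)
qed (simp add: birkhoff_sum_def)

text \<open>
  A bound for the logarithmic distortion of an iterate on the part of a cylinder that is
  mapped into \<open>{a..<1}\<close>.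
\<close>

definition distortion_bound :: "real \<Rightarrow> real" where
  "distortion_bound a = A * (g 1 - g a)"

lemma oscillation_le_distortion_bound:
  assumes "0 < a" "s \<in> {a..<1}" "t \<in> {a..<1}"
  shows "A * \<bar>g s - g t\<bar> \<le> distortion_bound a"
proof -
  have "g a \<le> g s" "g s \<le> g 1" "g a \<le> g t" "g t \<le> g 1"
    using g_mono assms by (auto simp: mono_on_def)
  then have "\<bar>g s - g t\<bar> \<le> g 1 - g a" by linarith
  then show ?thesis unfolding distortion_bound_def using A by (rule mult_left_mono)
qed

lemma iter_log_distance:
  assumes "same_itinerary n u v" "u \<noteq> v"
  shows "\<bar>ln \<bar>(f ^^ n) u - (f ^^ n) v\<bar> - ln \<bar>u - v\<bar> - birkhoff_sum n v\<bar>
           \<le> A * \<bar>g ((f ^^ n) u) - g ((f ^^ n) v)\<bar>"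
proof -
  have "A * (\<bar>g ((f ^^ n) u) - g ((f ^^ n) v)\<bar> - \<bar>g u - g v\<bar>) \<le> A * \<bar>g ((f ^^ n) u) - g ((f ^^ n) v)\<bar>"
    by (rule mult_left_mono) (use A in auto)
  with iter_distortion[OF assms] show ?thesis by (rule order_trans)
qed

lemma distance_lower:
  assumes "same_itinerary n u v" "A * \<bar>g ((f ^^ n) u) - g ((f ^^ n) v)\<bar> \<le> e"
  shows "exp (- e) * \<bar>(f ^^ n) u - (f ^^ n) v\<bar> * exp (- birkhoff_sum n v) \<le> \<bar>u - v\<bar>"
proof (cases "u = v")
  case False
  then have ne: "(f ^^ n) u \<noteq> (f ^^ n) v" using iter_inj[OF assms(1)] by blast
  have "\<bar>a - b - s\<bar> \<le> e \<Longrightarrow> - e + a + - s \<le> b" for a b s by linarith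
  then have "- e + ln \<bar>(f ^^ n) u - (f ^^ n) v\<bar> + - birkhoff_sum n v \<le> ln \<bar>u - v\<bar>"
    using order_trans[OF iter_log_distance[OF assms(1) False] assms(2)] .
  then have "exp (- e + ln \<bar>(f ^^ n) u - (f ^^ n) v\<bar> + - birkhoff_sum n v) \<le> exp (ln \<bar>u - v\<bar>)"
    by (simp only: exp_le_cancel_iff)
  then show ?thesis using False ne by (simp only: exp_add exp_ln zero_less_abs_iff right_minus_eq not_False_eq_True)
qed simp

lemma distance_upper:
  assumes "same_itinerary n u v" "A * \<bar>g ((f ^^ n) u) - g ((f ^^ n) v)\<bar> \<le> e"
  shows "\<bar>u - v\<bar> \<le> exp e * \<bar>(f ^^ n) u - (f ^^ n) v\<bar> * exp (- birkhoff_sum n v)"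
proof (cases "u = v")
  case False
  then have ne: "(f ^^ n) u \<noteq> (f ^^ n) v" using iter_inj[OF assms(1)] by blast
  have "\<bar>a - b - s\<bar> \<le> e \<Longrightarrow> b \<le> e + a + - s" for a b s by linarith
  then have "ln \<bar>u - v\<bar> \<le> e + ln \<bar>(f ^^ n) u - (f ^^ n) v\<bar> + - birkhoff_sum n v"
    using order_trans[OF iter_log_distance[OF assms(1) False] assms(2)] .
  then have "exp (ln \<bar>u - v\<bar>) \<le> exp (e + ln \<bar>(f ^^ n) u - (f ^^ n) v\<bar> + - birkhoff_sum n v)"
    by (simp only: exp_le_cancel_iff)
  then show ?thesis using False ne by (simp only: exp_add exp_ln zero_less_abs_iff right_minus_eq not_False_eq_True)
qed simp

lemma birkhoff_sum_compare:
  assumes "same_itinerary n u v" "A * \<bar>g ((f ^^ n) u) - g ((f ^^ n) v)\<bar> \<le> e"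
  shows "\<bar>birkhoff_sum n u - birkhoff_sum n v\<bar> \<le> 2 * e"
proof (cases "u = v")
  case True
  have "0 \<le> A * \<bar>g ((f ^^ n) u) - g ((f ^^ n) v)\<bar>" using A by simp
  then show ?thesis using True assms(2) by auto
next
  case False
  then have "\<bar>ln \<bar>(f ^^ n) u - (f ^^ n) v\<bar> - ln \<bar>u - v\<bar> - birkhoff_sum n v\<bar> \<le> e"
      "\<bar>ln \<bar>(f ^^ n) u - (f ^^ n) v\<bar> - ln \<bar>u - v\<bar> - birkhoff_sum n u\<bar> \<le> e"
    using order_trans[OF iter_log_distance[OF assms(1)] assms(2)]
      order_trans[OF iter_log_distance[OF same_itinerary_sym[OF assms(1)]], of e] assms(2)
    by (simp_all only: abs_minus_commute not_False_eq_True)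
  moreover have "\<bar>a - s\<bar> \<le> e \<Longrightarrow> \<bar>a - t\<bar> \<le> e \<Longrightarrow> \<bar>t - s\<bar> \<le> 2 * e" for a s t by linarith
  ultimately show ?thesis by blast
qed

text \<open>
  Points that are \<open>\<kappa>\<close> apart move apart at a uniform exponential rate as long as they take the same
  branch, and their distance cannot exceed 1; hence the order of a common cylinder is bounded.
\<close>

lemma cylinders_shrink:
  assumes "0 < \<kappa>"
  shows "\<exists>k0. \<forall>k\<ge>k0. \<forall>u v. same_itinerary k u v \<longrightarrow> \<bar>u - v\<bar> < \<kappa>"
proof -
  obtain \<mu> where \<mu>: "1 < \<mu>" "\<And>u v. same_branch r u v \<Longrightarrow> \<kappa> \<le> \<bar>u - v\<bar> \<Longrightarrow> \<mu> * \<bar>u - v\<bar> \<le> \<bar>f u - f v\<bar>"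
    using expand_uniformly[OF assms] by blast
  have grow: "\<mu> ^ k * \<kappa> \<le> \<bar>(f ^^ k) u - (f ^^ k) v\<bar>" if "same_itinerary k u v" "\<kappa> \<le> \<bar>u - v\<bar>" for k u v
    using that
  proof (induction k)
    case (Suc k)
    let ?u = "(f ^^ k) u" and ?v = "(f ^^ k) v"
    have *: "same_itinerary k u v" "same_branch r ?u ?v" using Suc.prems by (auto simp: same_itinerary_Suc)
    have "\<mu> ^ Suc k * \<kappa> = \<mu> * (\<mu> ^ k * \<kappa>)" by simp
    also have "\<dots> \<le> \<mu> * \<bar>?u - ?v\<bar>" using Suc * \<mu>(1) by simp
    also have "\<dots> \<le> \<bar>f ?u - f ?v\<bar>"
      using \<mu>(2) * iter_expand[OF *(1)] Suc.prems(2) by (meson order_trans)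
    finally show ?case by simp
  qed simp
  obtain k0 where k0: "1 / \<kappa> < \<mu> ^ k0" using real_arch_pow[OF \<mu>(1)] by blast
  have "\<bar>u - v\<bar> < \<kappa>" if k: "Suc k0 \<le> k" "same_itinerary k u v" for k u v
  proof (rule ccontr)
    assume "\<not> \<bar>u - v\<bar> < \<kappa>"
    moreover have s: "same_itinerary (Suc k0) u v" using k by (auto simp: same_itinerary_def)
    ultimately have "\<mu> ^ k0 * \<kappa> \<le> \<bar>(f ^^ k0) u - (f ^^ k0) v\<bar>" using grow by (auto simp: same_itinerary_Suc)
    moreover have "\<bar>(f ^^ k0) u - (f ^^ k0) v\<bar> < 1"
      using s r by (auto simp: same_itinerary_Suc same_branch_def)
    moreover have "1 < \<mu> ^ k0 * \<kappa>" using k0 assms by (simp add: field_simps)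
    ultimately show False by linarith
  qed
  then show ?thesis by blast
qed

text \<open>
  The size \<open>exp (- birkhoff_sum n y)\<close> of a preimage is \<open>1 / \<bar>(f\<^sup>n)' y\<bar>\<close>.
\<close>

definition preimages :: "real \<Rightarrow> (real \<times> real) set" where
  "preimages p = {(y, exp (- birkhoff_sum n y)) | y n. same_itinerary n y y \<and> (f ^^ n) y = p}"

text \<open>
  A preimage of \<open>p\<close> sits in the middle of its cylinder. The points of the cylinder that are mapped to
  \<open>p / 2\<close> and \<open>(1 + p) / 2\<close> lie on either side of it, at a distance comparable to its size by bounded
  distortion, and a point outside the cylinder lies beyond them.
\<close>

lemma neighbourhood_in_cylinder:
  assumes p: "p \<in> {0<..<1}" and y: "same_itinerary n y y" "(f ^^ n) y = p" and x: "\<not> same_itinerary n y x"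
  shows "exp (- distortion_bound (p / 2)) * (min p (1 - p) / 2) * exp (- birkhoff_sum n y) \<le> \<bar>x - y\<bar>"
proof -
  let ?m = "min p (1 - p) / 2"
  have "p / 2 \<in> {0<..<1}" "(1 + p) / 2 \<in> {0<..<1}" using p by auto
  then obtain y1 y2 where y12: "same_itinerary n y y1" "(f ^^ n) y1 = p / 2" "same_itinerary n y y2" "(f ^^ n) y2 = (1 + p) / 2"
    using branch_onto[OF y(1)] by meson
  have d: "exp (- distortion_bound (p / 2)) * ?m * exp (- birkhoff_sum n y) \<le> \<bar>z - y\<bar>"
    if z: "same_itinerary n y z" "(f ^^ n) z \<in> {p / 2..<1}" "?m \<le> \<bar>(f ^^ n) z - p\<bar>" for z
  proof -
    have "exp (- distortion_bound (p / 2)) * ?m * exp (- birkhoff_sum n y)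
            \<le> exp (- distortion_bound (p / 2)) * \<bar>(f ^^ n) z - (f ^^ n) y\<bar> * exp (- birkhoff_sum n y)"
      using z(3) y(2) by (intro mult_right_mono mult_left_mono) auto
    also have "\<dots> \<le> \<bar>z - y\<bar>"
      by (rule distance_lower[OF same_itinerary_sym[OF z(1)]], rule oscillation_le_distortion_bound) (use p z y in auto)
    finally show ?thesis .
  qed
  have d1: "exp (- distortion_bound (p / 2)) * ?m * exp (- birkhoff_sum n y) \<le> \<bar>y1 - y\<bar>"
    by (rule d) (use y12 p in auto)
  have d2: "exp (- distortion_bound (p / 2)) * ?m * exp (- birkhoff_sum n y) \<le> \<bar>y2 - y\<bar>"
    by (rule d) (use y12 p in \<open>auto simp: min_def field_simps\<close>)
  have out: "x \<notin> closed_segment y y1" "x \<notin> closed_segment y y2"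
    using same_itinerary_between x y12 by blast+
  have "y1 \<notin> closed_segment y y2" "y2 \<notin> closed_segment y y1"
    using same_itinerary_between[OF y12(3), of y1] same_itinerary_between[OF y12(1), of y2] y12 y p
    by (auto simp: closed_segment_eq_real_ivl)
  with out d1 d2 show ?thesis by (auto simp: closed_segment_eq_real_ivl split: if_splits)
qed

text \<open>
  The preimages \<open>y\<close> and \<open>y'\<close> have orders \<open>n\<close> and \<open>n + k\<close>. Outside the cylinder of \<open>y'\<close>
  the point \<open>y\<close> is far from \<open>y'\<close>. If it is in this cylinder, let \<open>q = f\<^sup>n y'\<close>, so that \<open>f\<^sup>k q = p\<close>
  and \<open>q\<close> shares the \<open>k\<close>-cylinder of \<open>p = f\<^sup>n y\<close>. For large \<open>k\<close> this cylinder is tiny, hence \<open>q\<close> is close to \<open>p\<close> and the sizes of the two preimages differ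
  by about the factor \<open>\<bar>(f\<^sup>k)' q\<bar>\<close>, which must be large. So comparable sizes leave only finitely
  many \<open>k\<close>, and for these \<open>f\<^bsup>n+k\<^esup>\<close> separates \<open>y\<close> from \<open>y'\<close>, sending them to \<open>f\<^sup>k p\<close> and \<open>p\<close>.
\<close>

lemma comparable_preimages_apart:
  assumes p: "p \<in> {0<..<1}"
  shows "\<exists>\<delta>>0. \<forall>n k y y'. same_itinerary n y y \<and> (f ^^ n) y = p \<and> same_itinerary (n + k) y' y' \<and> (f ^^ (n + k)) y' = p \<and>
           birkhoff_sum (n + k) y' \<le> birkhoff_sum n y + M \<and> y \<noteq> y' \<longrightarrow> \<delta> * exp (- birkhoff_sum (n + k) y') \<le> \<bar>y - y'\<bar>"
proof -
  define e where "e = distortion_bound (p / 2)"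
  \<comment> \<open>The second term is a lower bound for the length of the \<open>k\<close>-cylinder of \<open>p\<close> when the sizes are comparable.\<close>
  define \<kappa> where "\<kappa> = min (p / 2) (exp (- e) * (p / 2) * exp (- (M + 2 * e)))"
  have \<kappa>: "0 < \<kappa>" using p by (auto simp: \<kappa>_def)
  obtain k0 where k0: "\<And>k u v. k0 \<le> k \<Longrightarrow> same_itinerary k u v \<Longrightarrow> \<bar>u - v\<bar> < \<kappa>"
    using cylinders_shrink[OF \<kappa>] by blast
  let ?\<phi> = "\<lambda>k. exp (- (A * \<bar>g ((f ^^ k) p) - g p\<bar>)) * \<bar>(f ^^ k) p - p\<bar>"
  obtain \<delta>1 where \<delta>1: "0 < \<delta>1" "\<And>k. k < k0 \<Longrightarrow> (f ^^ k) p \<noteq> p \<Longrightarrow> \<delta>1 \<le> ?\<phi> k"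
    using finite_positive_lower_bound[of k0 "\<lambda>k. (f ^^ k) p \<noteq> p" ?\<phi>] by auto
  define \<delta>2 where "\<delta>2 = exp (- e) * (min p (1 - p) / 2)"
  have \<delta>2: "0 < \<delta>2" using p by (auto simp: \<delta>2_def)
  have "min \<delta>1 \<delta>2 * exp (- birkhoff_sum (n + k) y') \<le> \<bar>y - y'\<bar>"
    if y: "same_itinerary n y y" "(f ^^ n) y = p" and y': "same_itinerary (n + k) y' y'" "(f ^^ (n + k)) y' = p"
      and comp: "birkhoff_sum (n + k) y' \<le> birkhoff_sum n y + M" and "y \<noteq> y'" for n k y y'
  proof (cases "same_itinerary (n + k) y' y")
    case False
    have "min \<delta>1 \<delta>2 * exp (- birkhoff_sum (n + k) y') \<le> \<delta>2 * exp (- birkhoff_sum (n + k) y')"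
      by (intro mult_right_mono) auto
    also have "\<dots> \<le> \<bar>y - y'\<bar>"
      unfolding \<delta>2_def e_def by (rule neighbourhood_in_cylinder[OF p y' False])
    finally show ?thesis .
  next
    case True
    define q where "q = (f ^^ n) y'"
    have kq: "(f ^^ (n + k)) u = (f ^^ k) ((f ^^ n) u)" for u
      by (simp add: funpow_add add.commute[of n])
    have qp: "same_itinerary k q p" "same_itinerary n y' y" "(f ^^ k) q = p"
      using True y y' by (auto simp: same_itinerary_add q_def kq)
    have fkp: "(f ^^ (n + k)) y = (f ^^ k) p" using y by (simp add: kq)
    then have ne: "(f ^^ k) p \<noteq> p" using iter_inj[OF True] y'(2) \<open>y \<noteq> y'\<close> by auto
    have "k < k0"
    proof (rule ccontr)
      assume "\<not> k < k0"
      then have k: "k0 \<le> k" by simp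
      have "\<bar>q - p\<bar> < \<kappa>" using k0[OF k qp(1)] .
      moreover have "q \<in> {0<..<1}"
      proof (cases n)
        case 0
        then have "0 < k" using ne by (cases k) auto
        then have "same_itinerary (Suc 0) q p" using qp(1) by (auto simp: same_itinerary_def)
        then show ?thesis using r by (auto simp: same_itinerary_Suc same_branch_def)
      next
        case (Suc m)
        then show ?thesis using orbit_in_unit'[OF qp(2)] by (simp add: q_def)
      qed
      ultimately have q: "q \<in> {p / 2..<1}" by (auto simp: \<kappa>_def abs_if split: if_splits)
      have "\<bar>birkhoff_sum n y' - birkhoff_sum n y\<bar> \<le> 2 * e"
        by (rule birkhoff_sum_compare[OF qp(2)], unfold e_def, rule oscillation_le_distortion_bound) (use p q y in \<open>auto simp: q_def\<close>)
      then have Sk: "birkhoff_sum k q \<le> M + 2 * e" using comp by (simp add: birkhoff_sum_add q_def)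
      have qq: "same_itinerary k q q" using qp(1) same_itinerary_sym same_itinerary_trans by blast
      \<comment> \<open>The cylinder of \<open>p\<close> also contains a point that is mapped to \<open>p / 2\<close>, and this makes it too long.\<close>
      obtain q' where q': "same_itinerary k q q'" "(f ^^ k) q' = p / 2"
        using branch_onto[OF qq, of "p / 2"] p by auto
      have "\<kappa> \<le> exp (- e) * (p / 2) * exp (- (M + 2 * e))" by (simp add: \<kappa>_def)
      also have "\<dots> \<le> exp (- e) * (p / 2) * exp (- birkhoff_sum k q)"
        using Sk p by (intro mult_left_mono) auto
      also have "\<dots> = exp (- e) * \<bar>(f ^^ k) q' - (f ^^ k) q\<bar> * exp (- birkhoff_sum k q)"
        using q' qp p by simp
      also have "\<dots> \<le> \<bar>q' - q\<bar>"
        by (rule distance_lower[OF same_itinerary_sym[OF q'(1)]], unfold e_def, rule oscillation_le_distortion_bound) (use p q' qp in auto)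
      also have "\<dots> < \<kappa>" using k0[OF k same_itinerary_sym[OF q'(1)]] .
      finally show False by simp
    qed
    then have "min \<delta>1 \<delta>2 * exp (- birkhoff_sum (n + k) y') \<le> ?\<phi> k * exp (- birkhoff_sum (n + k) y')"
      using \<delta>1(2)[OF _ ne] by (intro mult_right_mono) auto
    also have "\<dots> = exp (- (A * \<bar>g ((f ^^ (n + k)) y) - g ((f ^^ (n + k)) y')\<bar>)) *
        \<bar>(f ^^ (n + k)) y - (f ^^ (n + k)) y'\<bar> * exp (- birkhoff_sum (n + k) y')"
      using fkp y' by simp
    also have "\<dots> \<le> \<bar>y - y'\<bar>" by (rule distance_lower[OF same_itinerary_sym[OF True]]) simp
    finally show ?thesis .
  qed
  then show ?thesis using \<delta>1(1) \<delta>2 by (intro exI[of _ "min \<delta>1 \<delta>2"]) auto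
qed

lemma scale_separated_preimages:
  assumes p: "p \<in> {0<..<1}"
  shows "scale_separated (preimages p)"
  unfolding scale_separated_def
proof
  fix N :: real
  define M where "M = ln (max N 1)"
  obtain \<delta> where \<delta>: "0 < \<delta>" and apart:
      "\<And>n k y y'. same_itinerary n y y \<Longrightarrow> (f ^^ n) y = p \<Longrightarrow> same_itinerary (n + k) y' y' \<Longrightarrow> (f ^^ (n + k)) y' = p \<Longrightarrow>
           birkhoff_sum (n + k) y' \<le> birkhoff_sum n y + M \<Longrightarrow> y \<noteq> y' \<Longrightarrow> \<delta> * exp (- birkhoff_sum (n + k) y') \<le> \<bar>y - y'\<bar>"
    using comparable_preimages_apart[OF p] by meson
  have "y = y'" if y: "same_itinerary n y y" "(f ^^ n) y = p" and y': "same_itinerary n' y' y'" "(f ^^ n') y' = p"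
      and \<rho>: "exp (- birkhoff_sum n y) \<le> exp (- birkhoff_sum n' y')" "exp (- birkhoff_sum n' y') \<le> N * exp (- birkhoff_sum n y)"
      and close: "\<bar>y - y'\<bar> \<le> \<delta> / 2 * exp (- birkhoff_sum n y)" for y n y' n'
  proof (rule ccontr)
    assume ne: "y \<noteq> y'"
    have le: "birkhoff_sum n' y' \<le> birkhoff_sum n y" using \<rho> by simp
    have "exp (- birkhoff_sum n' y') \<le> max N 1 * exp (- birkhoff_sum n y)"
      using \<rho>(2) by (rule order_trans) (auto intro: mult_right_mono)
    also have "\<dots> = exp (M - birkhoff_sum n y)" by (simp add: M_def exp_diff exp_minus divide_inverse)
    finally have le': "birkhoff_sum n y \<le> birkhoff_sum n' y' + M" by simp
    have "\<delta> * exp (- birkhoff_sum n y) \<le> \<bar>y - y'\<bar>"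
    proof (cases "n \<le> n'")
      case True
      then obtain k where k: "n' = n + k" using le_Suc_ex by blast
      have "0 \<le> M" by (simp add: M_def)
      then have "\<delta> * exp (- birkhoff_sum n' y') \<le> \<bar>y - y'\<bar>"
        using apart[of n y k y'] y y' le ne by (simp add: k)
      moreover have "\<delta> * exp (- birkhoff_sum n y) \<le> \<delta> * exp (- birkhoff_sum n' y')" using \<rho> \<delta> by simp
      ultimately show ?thesis by linarith
    next
      case False
      then obtain k where k: "n = n' + k" using le_Suc_ex nat_le_linear by blast
      then show ?thesis using apart[of n' y' k y] y y' le' ne by (simp add: abs_minus_commute)
    qed
    moreover have "\<delta> / 2 * exp (- birkhoff_sum n y) < \<delta> * exp (- birkhoff_sum n y)" using \<delta> by simp
    ultimately show False using close by linarith
  qed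
  then show "\<exists>\<delta>>0. \<forall>(y, \<rho>)\<in>preimages p. \<forall>(y', \<rho>')\<in>preimages p.
      0 < \<rho> \<and> \<rho> \<le> \<rho>' \<and> \<rho>' \<le> N * \<rho> \<and> \<bar>y - y'\<bar> \<le> \<delta> * \<rho> \<longrightarrow> y = y'"
    using \<delta> by (intro exI[of _ "\<delta> / 2"]) (auto simp: preimages_def)
qed

text \<open>
  If an iterate \<open>f\<^sup>n x\<close> is close to \<open>p\<close>, pull \<open>p\<close> back along the branch of \<open>x\<close>: by bounded distortion
  this gives a preimage whose distance to \<open>x\<close> is small compared with its size, against the choice
  of \<open>x\<close>. The preimages that are too big to count belong to big cylinders around \<open>x\<close>, and there are
  only finitely many of these.
\<close>

lemma badly_approximable_avoids:
  assumes p: "p \<in> {0<..<1}" and x: "x \<in> {0<..<1}" "\<And>n. same_itinerary n x x" "\<And>n. (f ^^ n) x \<noteq> p"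
    and bad: "x \<in> badly_approximable (preimages p)"
  shows "\<exists>\<eta>>0. \<forall>n. \<eta> \<le> \<bar>(f ^^ n) x - p\<bar>"
proof -
  define e where "e = distortion_bound (p / 2)"
  obtain \<epsilon> where \<epsilon>: "0 < \<epsilon>"
    and far: "\<And>n y. same_itinerary n y y \<Longrightarrow> (f ^^ n) y = p \<Longrightarrow> exp (- birkhoff_sum n y) \<le> \<epsilon> \<Longrightarrow> \<epsilon> * exp (- birkhoff_sum n y) \<le> \<bar>x - y\<bar>"
    using bad unfolding badly_approximable_def preimages_def by fastforce
  define \<kappa> where "\<kappa> = exp (- e) * (p / 2) * \<epsilon>"
  have \<kappa>: "0 < \<kappa>" using p \<epsilon> by (simp add: \<kappa>_def)
  obtain k0 where k0: "\<And>k u v. k0 \<le> k \<Longrightarrow> same_itinerary k u v \<Longrightarrow> \<bar>u - v\<bar> < \<kappa>"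
    using cylinders_shrink[OF \<kappa>] by blast
  obtain \<eta>0 where \<eta>0: "0 < \<eta>0" "\<And>k. k < k0 \<Longrightarrow> \<eta>0 \<le> \<bar>(f ^^ k) x - p\<bar>"
    using finite_positive_lower_bound[of k0 "\<lambda>_. True" "\<lambda>k. \<bar>(f ^^ k) x - p\<bar>"] x(3) by auto
  define \<eta> where "\<eta> = min (min \<eta>0 (p / 2)) (\<epsilon> * exp (- e))"
  have "\<eta> \<le> \<bar>(f ^^ n) x - p\<bar>" for n
  proof (cases "n < k0 \<or> (f ^^ n) x < p / 2")
    case True
    then show ?thesis using \<eta>0(2)[of n] by (auto simp: \<eta>_def)
  next
    case False
    have fx: "(f ^^ n) x \<in> {p / 2..<1}" using False orbit_in_unit[OF x(2) x(1), of n] by auto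
    obtain y where y: "same_itinerary n x y" "(f ^^ n) y = p" using branch_onto[OF x(2) p] by blast
    have yy: "same_itinerary n y y" using y same_itinerary_sym same_itinerary_trans by blast
    obtain y' where y': "same_itinerary n y y'" "(f ^^ n) y' = p / 2"
      using branch_onto[OF yy, of "p / 2"] p by auto
    have "exp (- e) * \<bar>(f ^^ n) y' - (f ^^ n) y\<bar> * exp (- birkhoff_sum n y) \<le> \<bar>y' - y\<bar>"
      by (rule distance_lower[OF same_itinerary_sym[OF y'(1)]], unfold e_def, rule oscillation_le_distortion_bound) (use p y' y in auto)
    also have "\<dots> < exp (- e) * (p / 2) * \<epsilon>"
      using k0[OF _ same_itinerary_sym[OF y'(1)]] False by (auto simp: \<kappa>_def)
    finally have "exp (- e) * (p / 2) * exp (- birkhoff_sum n y) < exp (- e) * (p / 2) * \<epsilon>"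
      using y' y p by simp
    then have "exp (- birkhoff_sum n y) \<le> \<epsilon>" using p by simp
    then have "\<epsilon> * exp (- birkhoff_sum n y) \<le> \<bar>x - y\<bar>" using far yy y by blast
    also have "\<dots> \<le> exp e * \<bar>(f ^^ n) x - (f ^^ n) y\<bar> * exp (- birkhoff_sum n y)"
      by (rule distance_upper[OF y(1)], unfold e_def, rule oscillation_le_distortion_bound) (use p fx y in auto)
    finally have "\<epsilon> \<le> exp e * \<bar>(f ^^ n) x - p\<bar>" using y by simp
    then have "\<epsilon> * exp (- e) \<le> \<bar>(f ^^ n) x - p\<bar>" by (simp add: exp_minus field_simps)
    then show ?thesis by (simp add: \<eta>_def)
  qed
  moreover have "0 < \<eta>" using \<eta>0 p \<epsilon> by (simp add: \<eta>_def)
  ultimately show ?thesis by blast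
qed

text \<open>
  A branch expands and has its image in the unit interval, so a point at distance \<open>z\<close> from both
  ends of the branch is mapped to a point at distance at least \<open>z\<close> from 0 and 1. The ends of the branch
  are approached through \<open>a + t\<close> and \<open>b - t\<close>.
\<close>

lemma image_away_from_ends:
  assumes c: "c \<in> {0<..<r} \<or> c \<in> {r<..<1}" and z: "z \<le> c" "z \<le> 1 - c" "z \<le> \<bar>c - r\<bar>"
  shows "z \<le> f c \<and> z \<le> 1 - f c"
proof -
  define a b where "a = (if c < r then 0 else r)" and "b = (if c < r then r else 1)"
  have ab: "a < c" "c < b" "z \<le> c - a" "z \<le> b - c" using c z r by (auto simp: a_def b_def)
  have sb: "same_branch r u v" if "u \<in> {a<..<b}" "v \<in> {a<..<b}" for u v
    using that c by (auto simp: same_branch_def a_def b_def split: if_splits)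
  have fc: "f c \<in> {0<..<1}" using same_branch_range[OF sb[of c c]] ab by auto
  have "z \<le> f c + t \<and> z \<le> 1 - f c + t" if t: "0 < t" for t
  proof (cases "a + t < c \<and> c < b - t")
    case True
    let ?u = "a + t" and ?v = "b - t"
    have uv: "?u \<in> {a<..<b}" "?v \<in> {a<..<b}" "c \<in> closed_segment ?u ?v" "c \<in> {a<..<b}"
      using True ab t by (auto simp: closed_segment_eq_real_ivl)
    have "f ?u \<in> {0<..<1}" "f ?v \<in> {0<..<1}" using same_branch_range sb uv by blast+
    moreover have "f c \<in> closed_segment (f ?u) (f ?v)" using between sb uv by blast
    moreover have "\<bar>c - ?u\<bar> \<le> \<bar>f c - f ?u\<bar>" "\<bar>?v - c\<bar> \<le> \<bar>f ?v - f c\<bar>" using expand sb uv by blast+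
    ultimately show ?thesis using True ab
      by (auto simp: closed_segment_eq_real_ivl split: if_splits)
  next
    case False
    then show ?thesis using fc ab by auto
  qed
  then show ?thesis by (meson field_le_epsilon)
qed

lemma orbit_away_from_ends:
  assumes x: "x \<in> {0<..<1}" "\<And>n. same_itinerary n x x"
    and \<eta>: "0 < \<eta>" "\<And>n. \<eta> \<le> \<bar>(f ^^ n) x - r\<bar>"
  shows "\<exists>\<zeta>>0. \<forall>n. \<zeta> \<le> (f ^^ n) x \<and> \<zeta> \<le> 1 - (f ^^ n) x"
proof -
  define \<zeta> where "\<zeta> = min \<eta> (min x (1 - x))"
  have "\<zeta> \<le> (f ^^ n) x \<and> \<zeta> \<le> 1 - (f ^^ n) x" for n
  proof (induction n)
    case (Suc n)
    have "(f ^^ n) x \<in> {0<..<r} \<or> (f ^^ n) x \<in> {r<..<1}"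
      using x(2)[of "Suc n"] by (auto simp: same_itinerary_Suc same_branch_def)
    moreover have "\<zeta> \<le> \<bar>(f ^^ n) x - r\<bar>" using \<eta>(2)[of n] by (simp add: \<zeta>_def)
    ultimately show ?case using image_away_from_ends Suc by simp
  qed (auto simp: \<zeta>_def)
  moreover have "0 < \<zeta>" using x \<eta> by (simp add: \<zeta>_def)
  ultimately show ?thesis by blast
qed

lemma f_inj: "inj_on f {0<..<r}" "inj_on f {r<..<1}"
proof -
  have "u = v" if "same_branch r u v" "f u = f v" for u v using expand[OF that(1)] that(2) by simp
  then show "inj_on f {0<..<r}" "inj_on f {r<..<1}" by (auto simp: inj_on_def same_branch_def)
qed

lemma countable_preimage:
  assumes "countable C"
  shows "countable {x \<in> {0..1}. f x \<in> C}"
proof -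
  have "countable {x \<in> T. f x \<in> C}" if "inj_on f T" for T
  proof (rule countable_image_inj_on)
    show "countable (f ` {x \<in> T. f x \<in> C})" by (rule countable_subset[OF _ assms]) auto
    show "inj_on f {x \<in> T. f x \<in> C}" using that by (rule inj_on_subset) auto
  qed
  then have "countable ({0, r, 1} \<union> {x \<in> {0<..<r}. f x \<in> C} \<union> {x \<in> {r<..<1}. f x \<in> C})"
    using f_inj by (intro countable_Un) blast+
  then show ?thesis by (rule countable_subset[rotated]) auto
qed

lemma countable_iterated_preimage:
  assumes "countable C" and maps: "f ` {0..1} \<subseteq> {0..1}"
  shows "countable {x \<in> {0..1}. (f ^^ n) x \<in> C}"
proof (induction n)
  case 0
  show ?case by (rule countable_subset[OF _ assms(1)]) auto
next
  case (Suc n)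
  have "{x \<in> {0..1}. (f ^^ Suc n) x \<in> C} \<subseteq> {x \<in> {0..1}. f x \<in> {x \<in> {0..1}. (f ^^ n) x \<in> C}}"
    using maps by (auto simp only: funpow_Suc_right o_apply)
  then show ?case using countable_preimage[OF Suc] countable_subset by blast
qed

text \<open>
  Alice avoids the preimages of \<open>r\<close> and of the points of \<open>P\<close> inside the unit interval at their natural
  scale. In addition she avoids each of the countably many points whose orbit hits \<open>P\<close> or
  an end of a branch, so that the itinerary of the resulting point is defined forever.
\<close>

theorem absolute_winning_exceptional_set:
  assumes maps: "f ` {0..1} \<subseteq> {0..1}" and P: "countable P" "P \<subseteq> {0..1}"
  shows "absolute_winning {0..1} (exceptional_set f P)"
proof -
  define Q where "Q = (\<Union>n. {x \<in> {0..1}. (f ^^ n) x \<in> P \<union> {0, r, 1}})"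
  define \<F> where "\<F> = preimages ` (insert r (P \<inter> {0<..<1})) \<union> (\<lambda>y. {y} \<times> {0<..}) ` Q"
  have Q: "countable Q"
    unfolding Q_def using P by (intro countable_UN countable_iterated_preimage[OF _ maps]) auto
  show ?thesis
  proof (rule absolute_winning_badly_approximable)
    show "countable \<F>" unfolding \<F>_def using P Q by (intro countable_Un countable_image countable_insert) auto
    show "scale_separated F" if "F \<in> \<F>" for F
      using that r scale_separated_preimages scale_separated_point unfolding \<F>_def by auto
    show "exceptional_set f P \<subseteq> {0..1}" by (auto simp: exceptional_set_def)
    fix x :: real assume x: "x \<in> {0..1}" and bad: "\<And>F. F \<in> \<F> \<Longrightarrow> x \<in> badly_approximable F"
    have orbit: "(f ^^ n) x \<in> {0..1}" for n
      using maps by (induction n) (use x in \<open>auto simp only: funpow.simps o_apply id_apply\<close>)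
    have "x \<noteq> y" if "y \<in> Q" for y
      using bad[of "{y} \<times> {0<..}"] badly_approximable_point that unfolding \<F>_def by blast
    then have "x \<notin> Q" by blast
    then have miss: "(f ^^ n) x \<notin> P" "(f ^^ n) x \<noteq> 0" "(f ^^ n) x \<noteq> r" "(f ^^ n) x \<noteq> 1" for n
      using x by (auto simp: Q_def)
    have x01: "x \<in> {0<..<1}" using x miss[of 0] by auto
    have itin: "same_itinerary n x x" for n
      unfolding same_itinerary_def
    proof (intro allI impI)
      show "same_branch r ((f ^^ i) x) ((f ^^ i) x)" for i
        using orbit[of i] miss[of i] by (auto simp: same_branch_def)
    qed
    have away: "\<exists>\<eta>>0. \<forall>n. \<eta> \<le> \<bar>(f ^^ n) x - p\<bar>" if p: "p \<in> insert r (P \<inter> {0<..<1})" for p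
    proof (rule badly_approximable_avoids[OF _ x01 itin])
      show "p \<in> {0<..<1}" using p r by auto
      show "(f ^^ n) x \<noteq> p" for n using miss[of n] p by auto
      show "x \<in> badly_approximable (preimages p)" using p by (intro bad) (auto simp: \<F>_def)
    qed
    obtain \<zeta> where \<zeta>: "0 < \<zeta>" "\<And>n. \<zeta> \<le> (f ^^ n) x \<and> \<zeta> \<le> 1 - (f ^^ n) x"
      using orbit_away_from_ends[OF x01 itin] away[of r] by blast
    have "p \<notin> closure (range (\<lambda>n. (f ^^ n) x))" if p: "p \<in> P" for p
    proof -
      have "p \<in> insert r (P \<inter> {0<..<1}) \<or> p = 0 \<or> p = 1" using p P by force
      then have "\<exists>\<eta>>0. \<forall>n. \<eta> \<le> \<bar>(f ^^ n) x - p\<bar>"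
      proof (elim disjE)
        assume "p = 0"
        then show ?thesis using \<zeta> by (intro exI[of _ \<zeta>]) (auto intro: order_trans[OF _ abs_ge_self])
      next
        assume "p = 1"
        have "\<zeta> \<le> \<bar>(f ^^ n) x - 1\<bar>" for n using \<zeta>(2)[of n] by linarith
        then show ?thesis using \<zeta>(1) \<open>p = 1\<close> by blast
      qed (rule away)
      then obtain \<eta> where "0 < \<eta>" "\<And>n. \<not> dist ((f ^^ n) x) p < \<eta>"
        by (auto simp: dist_real_def not_less)
      then show ?thesis unfolding closure_approachable by blast
    qed
    then show "x \<in> exceptional_set f P" using x by (auto simp: exceptional_set_def)
  qed
qed

end

section \<open>Smooth expanding branches\<close>

lemma continuous_nonzero_constant_sign:
  fixes F :: "real \<Rightarrow> real"
  assumes "continuous_on {a..b} F" "\<And>x. x \<in> {a..b} \<Longrightarrow> F x \<noteq> 0"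
  shows "\<exists>s\<in>{1, -1}. \<forall>x\<in>{a..b}. 0 < s * F x"
proof (rule ccontr)
  assume no: "\<not> ?thesis"
  obtain x y where xy: "x \<in> {a..b}" "F x \<le> 0" "y \<in> {a..b}" "0 \<le> F y"
    using no by (auto simp: not_less)
  have "connected (F ` {a..b})" using assms(1) by (intro connected_continuous_image) auto
  then have "0 \<in> F ` {a..b}" by (rule connectedD_interval) (use xy in auto)
  then show False using assms(2) by force
qed

text \<open>
  The difference quotient at \<open>a\<close> is a value of \<open>R'\<close> between \<open>a\<close> and \<open>x\<close>, and by the bound on
  \<open>R''\<close> it differs from \<open>R' x\<close> by at most \<open>B (x - a)\<close>. Hence \<open>R' x\<close> has the same limit as the
  difference quotient.
\<close>

lemma derivative_continuous_at_left_end: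
  fixes R R' R'' :: "real \<Rightarrow> real"
  assumes ab: "a < b"
    and R: "\<And>x. x \<in> {a..b} \<Longrightarrow> (R has_real_derivative R' x) (at x within {a..b})"
    and R': "\<And>x. x \<in> {a<..b} \<Longrightarrow> (R' has_real_derivative R'' x) (at x within {a<..b})"
    and bound: "\<And>x. x \<in> {a<..b} \<Longrightarrow> \<bar>R'' x\<bar> \<le> B"
  shows "continuous_on {a..b} R'"
proof -
  have est: "\<bar>(R x - R a) / (x - a) - R' x\<bar> \<le> B * (x - a)" if x: "x \<in> {a<..b}" for x
  proof -
    have "\<exists>z\<in>{a<..<x}. R x - R a = R' z * (x - a)"
    proof (rule mvt_simple)
      fix t assume "a \<le> t" "t \<le> x"
      then have "(R has_real_derivative R' t) (at t within {a..x})"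
        using x by (intro DERIV_subset[OF R]) auto
      then show "(R has_derivative (*) (R' t)) (at t within {a..x})"
        by (simp only: has_field_derivative_def)
    qed (use x in simp)
    then obtain z where z: "z \<in> {a<..<x}" "R x - R a = R' z * (x - a)" by blast
    have "\<exists>t\<in>{z<..<x}. R' x - R' z = R'' t * (x - z)"
    proof (rule mvt_simple)
      fix t assume "z \<le> t" "t \<le> x"
      then have "(R' has_real_derivative R'' t) (at t within {z..x})"
        using x z by (intro DERIV_subset[OF R']) auto
      then show "(R' has_derivative (*) (R'' t)) (at t within {z..x})"
        by (simp only: has_field_derivative_def)
    qed (use z in simp)
    then obtain t where t: "t \<in> {z<..<x}" "R' x - R' z = R'' t * (x - z)" by blast
    have "\<bar>R' z - R' x\<bar> = \<bar>R'' t\<bar> * (x - z)" using t by (simp add: abs_minus_commute abs_mult)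
    also have "\<dots> \<le> B * (x - a)" using bound[of t] t z x by (intro mult_mono) auto
    finally show ?thesis using z x by simp
  qed
  have zero: "((\<lambda>x. B * (x - a)) \<longlongrightarrow> 0) (at a within {a..b})"
    by (auto intro!: tendsto_eq_intros)
  have "((\<lambda>x. (R x - R a) / (x - a) - R' x) \<longlongrightarrow> 0) (at a within {a..b})"
    by (rule Lim_null_comparison[OF _ zero]) (use est in \<open>auto simp: eventually_at_filter\<close>)
  moreover have "((\<lambda>x. (R x - R a) / (x - a)) \<longlongrightarrow> R' a) (at a within {a..b})"
    using R[of a] ab by (simp add: has_field_derivative_iff)
  ultimately have "(R' \<longlongrightarrow> R' a) (at a within {a..b})"
    using tendsto_diff by fastforce
  then have at_a: "continuous (at a within {a..b}) R'" by (simp add: continuous_within)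
  show ?thesis unfolding continuous_on_eq_continuous_within
  proof
    fix x assume x: "x \<in> {a..b}"
    show "continuous (at x within {a..b}) R'"
    proof (cases "x = a")
      case False
      then have x': "x \<in> {a<..b}" using x by auto
      have "at x within {a..b} = at x within {a<..b}"
        by (rule at_within_nhd[of x "{a<..}"]) (use x' in auto)
      then show ?thesis using DERIV_continuous[OF R'[OF x']] by simp
    qed (use at_a in simp)
  qed
qed

text \<open>
  The sign \<open>s\<close> covers both orientations of a branch.
\<close>

locale expanding_branch =
  fixes f F' :: "real \<Rightarrow> real" and a b s :: real
  assumes deriv: "x \<in> {a<..<b} \<Longrightarrow> (f has_real_derivative F' x) (at x)"
    and sign: "s \<in> {1, -1}"
    and expanding: "x \<in> {a<..<b} \<Longrightarrow> 1 \<le> s * F' x"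
begin

lemma abs_F': "x \<in> {a<..<b} \<Longrightarrow> \<bar>F' x\<bar> = s * F' x"
  using expanding[of x] sign by auto

lemma mean_value:
  assumes "u \<in> {a<..<b}" "v \<in> {a<..<b}" "u < v"
  shows "\<exists>z\<in>{u<..<v}. s * (f v - f u) = \<bar>F' z\<bar> * (v - u)"
proof -
  obtain z where "u < z" "z < v" "f v - f u = (v - u) * F' z"
    using MVT2[of u v f F'] deriv assms by force
  then show ?thesis using abs_F'[of z] assms by (intro bexI[of _ z]) auto
qed

lemma abs_diff: "u \<in> {a<..<b} \<Longrightarrow> v \<in> {a<..<b} \<Longrightarrow> u < v \<Longrightarrow> \<bar>f v - f u\<bar> = s * (f v - f u)"
proof -
  assume uv: "u \<in> {a<..<b}" "v \<in> {a<..<b}" "u < v"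
  then obtain z where "s * (f v - f u) = \<bar>F' z\<bar> * (v - u)" using mean_value by blast
  then have "0 \<le> s * (f v - f u)" using uv by simp
  then show ?thesis using sign by auto
qed

lemma expand_by:
  assumes "u \<in> {a<..<b}" "v \<in> {a<..<b}" "u \<le> v" "\<And>z. z \<in> {u<..<v} \<Longrightarrow> m \<le> \<bar>F' z\<bar>"
  shows "m * (v - u) \<le> s * (f v - f u)"
proof (cases "u = v")
  case False
  then obtain z where z: "z \<in> {u<..<v}" "s * (f v - f u) = \<bar>F' z\<bar> * (v - u)"
    using mean_value[of u v] assms by auto
  then show ?thesis using assms(3) assms(4)[OF z(1)] by (simp add: mult_right_mono)
qed simp

lemma expand_abs:
  assumes "u \<in> {a<..<b}" "v \<in> {a<..<b}" "\<And>z. z \<in> {a<..<b} \<Longrightarrow> m \<le> \<bar>F' z\<bar>"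
  shows "m * \<bar>u - v\<bar> \<le> \<bar>f u - f v\<bar>"
proof -
  have *: "m * (v - u) \<le> \<bar>f v - f u\<bar>" if "u \<in> {a<..<b}" "v \<in> {a<..<b}" "u \<le> v" for u v
  proof -
    have "m * (v - u) \<le> s * (f v - f u)" using that assms(3) by (intro expand_by) auto
    also have "\<dots> \<le> \<bar>f v - f u\<bar>" using sign by auto
    finally show ?thesis .
  qed
  show ?thesis using *[of u v] *[of v u] assms by (cases "u \<le> v") (auto simp: abs_minus_commute)
qed

lemma between:
  assumes "u \<in> {a<..<b}" "v \<in> {a<..<b}" "w \<in> closed_segment u v"
  shows "f w \<in> closed_segment (f u) (f v)"
proof -
  have *: "s * f x \<le> s * f y" if "x \<in> {a<..<b}" "y \<in> {a<..<b}" "x \<le> y" for x y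
    using expand_by[OF that, of 0] by (simp add: algebra_simps)
  show ?thesis
  proof (cases "u \<le> v")
    case True
    then have "u \<le> w" "w \<le> v" "w \<in> {a<..<b}" using assms by (auto simp: closed_segment_eq_real_ivl)
    then show ?thesis using *[of u w] *[of w v] assms sign by (auto simp: closed_segment_eq_real_ivl)
  next
    case False
    then have "v \<le> w" "w \<le> u" "w \<in> {a<..<b}" using assms by (auto simp: closed_segment_eq_real_ivl)
    then show ?thesis using *[of v w] *[of w u] assms sign by (auto simp: closed_segment_eq_real_ivl)
  qed
qed

text \<open>
  Here \<open>w = g'\<close>. The hypothesis on \<open>F''\<close> says that \<open>ln \<bar>f'\<bar>\<close> varies no faster than \<open>c\<close> times
  the surplus density \<open>\<bar>f'\<bar> (w \<circ> f) - w\<close>, whose integral from \<open>u\<close> to \<open>v\<close> is the growth of the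
  \<open>g\<close>-distance. In the proof \<open>h\<close> is a primitive of \<open>c\<close> times this density and \<open>l = ln \<bar>f'\<bar>\<close>.
\<close>

lemma tempered_distortion:
  assumes range: "\<And>x. x \<in> {a<..<b} \<Longrightarrow> f x \<in> {0<..<1}" and sub: "{a<..<b} \<subseteq> {0<..<1}"
    and second: "\<And>x. x \<in> {a<..<b} \<Longrightarrow> (F' has_real_derivative F'' x) (at x)"
    and g: "\<And>y. y \<in> {0<..<1} \<Longrightarrow> (g has_real_derivative w y) (at y)" "mono_on {0<..1} g"
    and tempered: "\<And>x. x \<in> {a<..<b} \<Longrightarrow> \<bar>F'' x\<bar> \<le> c * (\<bar>F' x\<bar> * w (f x) - w x)"
    and uv: "u \<in> {a<..<b}" "v \<in> {a<..<b}" "u \<noteq> v"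
  shows "\<bar>ln \<bar>f u - f v\<bar> - ln \<bar>u - v\<bar> - ln \<bar>F' v\<bar>\<bar> \<le> c * (\<bar>g (f u) - g (f v)\<bar> - \<bar>g u - g v\<bar>)"
proof -
  define h where "h x = c * (s * g (f x) - g x)" for x
  define l where "l x = ln (s * F' x)" for x
  have dh: "(h has_real_derivative c * (\<bar>F' x\<bar> * w (f x) - w x)) (at x)" if x: "x \<in> {a<..<b}" for x
  proof -
    have "((\<lambda>x. g (f x)) has_real_derivative w (f x) * F' x) (at x)"
      by (rule DERIV_chain2[OF g(1)[OF range[OF x]] deriv[OF x]])
    moreover have "(g has_real_derivative w x) (at x)" using g(1) sub x by blast
    ultimately have "(h has_real_derivative c * (s * (w (f x) * F' x) - w x)) (at x)"
      unfolding h_def by (auto intro!: derivative_eq_intros)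
    then show ?thesis by (simp add: abs_F'[OF x] mult_ac)
  qed
  have dl: "(l has_real_derivative F'' x / F' x) (at x)" if x: "x \<in> {a<..<b}" for x
  proof -
    have "(l has_real_derivative (s * F'' x) / (s * F' x)) (at x)"
      unfolding l_def using second[OF x] expanding[OF x] by (auto intro!: derivative_eq_intros)
    then show ?thesis using sign by auto
  qed
  have dom: "\<bar>F'' x / F' x\<bar> \<le> c * (\<bar>F' x\<bar> * w (f x) - w x)" if x: "x \<in> {a<..<b}" for x
  proof -
    have "\<bar>F'' x\<bar> / \<bar>F' x\<bar> \<le> \<bar>F'' x\<bar> / 1"
      by (rule divide_left_mono) (use expanding[OF x] abs_F'[OF x] in auto)
    then show ?thesis using tempered[OF x] by (simp add: abs_divide)
  qed
  have osc: "\<bar>l y - l x\<bar> \<le> h y - h x" if xy: "x \<in> {a<..<b}" "y \<in> {a<..<b}" "x \<le> y" for x y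
  proof -
    have in_ab: "t \<in> {a<..<b}" if "x \<le> t" "t \<le> y" for t using that xy by auto
    have "h x - l x \<le> h y - l y"
    proof (rule DERIV_nonneg_imp_nondecreasing[OF xy(3)])
      fix t assume "x \<le> t" "t \<le> y"
      then have t: "t \<in> {a<..<b}" by (rule in_ab)
      show "\<exists>y. ((\<lambda>t. h t - l t) has_real_derivative y) (at t) \<and> 0 \<le> y"
        by (rule exI, rule conjI, rule DERIV_diff[OF dh[OF t] dl[OF t]]) (use dom[OF t] in linarith)
    qed
    moreover have "h x + l x \<le> h y + l y"
    proof (rule DERIV_nonneg_imp_nondecreasing[OF xy(3)])
      fix t assume "x \<le> t" "t \<le> y"
      then have t: "t \<in> {a<..<b}" by (rule in_ab)
      show "\<exists>y. ((\<lambda>t. h t + l t) has_real_derivative y) (at t) \<and> 0 \<le> y"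
        by (rule exI, rule conjI, rule DERIV_add[OF dh[OF t] dl[OF t]]) (use dom[OF t] in linarith)
    qed
    ultimately show ?thesis by linarith
  qed
  have key: "\<bar>ln \<bar>f y - f x\<bar> - ln \<bar>y - x\<bar> - l e\<bar> \<le> c * (\<bar>g (f y) - g (f x)\<bar> - \<bar>g y - g x\<bar>)"
    if xy: "x \<in> {a<..<b}" "y \<in> {a<..<b}" "x < y" and e: "e = x \<or> e = y" for x y e
  proof -
    obtain z where z: "z \<in> {x<..<y}" "s * (f y - f x) = \<bar>F' z\<bar> * (y - x)"
      using mean_value[OF xy] by blast
    have zab: "z \<in> {a<..<b}" using z xy by auto
    have F'z: "\<bar>F' z\<bar> = s * F' z" "0 < s * F' z" using abs_F'[OF zab] expanding[OF zab] by auto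
    have "ln \<bar>f y - f x\<bar> = ln (s * F' z * (y - x))" using abs_diff[OF xy] z F'z by simp
    also have "\<dots> = l z + ln (y - x)" unfolding l_def using xy F'z(2) by (intro ln_mult_pos) auto
    finally have "ln \<bar>f y - f x\<bar> - ln \<bar>y - x\<bar> - l e = l z - l e" using xy by simp
    moreover have "\<bar>l z - l e\<bar> \<le> h y - h x"
    proof -
      have "\<bar>l z - l x\<bar> \<le> h z - h x" "\<bar>l y - l z\<bar> \<le> h y - h z"
        using osc[of x z] osc[of z y] xy zab z by auto
      then show ?thesis using e by (elim disjE; hypsubst; linarith)
    qed
    ultimately have "\<bar>ln \<bar>f y - f x\<bar> - ln \<bar>y - x\<bar> - l e\<bar> \<le> h y - h x" by simp
    also have "h y - h x = c * (s * (g (f y) - g (f x)) - (g y - g x))" by (simp add: h_def algebra_simps)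
    also have "s * (g (f y) - g (f x)) = \<bar>g (f y) - g (f x)\<bar>"
    proof -
      have fxy: "f x \<in> {0<..1}" "f y \<in> {0<..1}" using range[OF xy(1)] range[OF xy(2)] by auto
      have inc: "0 < s * (f y - f x)" unfolding z(2) F'z(1) using F'z(2) xy by simp
      show ?thesis
      proof (cases "s = 1")
        case True
        then have "g (f x) \<le> g (f y)" using inc fxy by (intro mono_onD[OF g(2)]) auto
        then show ?thesis using True by simp
      next
        case False
        then have s: "s = -1" using sign by simp
        then have "g (f y) \<le> g (f x)" using inc fxy by (intro mono_onD[OF g(2)]) auto
        then show ?thesis using s by simp
      qed
    qed
    also have "g y - g x = \<bar>g y - g x\<bar>"
    proof -
      have "x \<in> {0<..<1}" "y \<in> {0<..<1}" using sub xy by blast+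
      then have "g x \<le> g y" using xy by (intro mono_onD[OF g(2)]) auto
      then show ?thesis by simp
    qed
    finally show ?thesis .
  qed
  have "ln \<bar>F' v\<bar> = l v" using abs_F'[OF uv(2)] by (simp add: l_def)
  moreover have "\<bar>ln \<bar>f u - f v\<bar> - ln \<bar>u - v\<bar> - l v\<bar> \<le> c * (\<bar>g (f u) - g (f v)\<bar> - \<bar>g u - g v\<bar>)"
  proof (cases "u < v")
    case True
    show ?thesis
      unfolding abs_minus_commute[of "f u" "f v"] abs_minus_commute[of u v]
        abs_minus_commute[of "g u" "g v"] abs_minus_commute[of "g (f u)" "g (f v)"]
      using key[OF uv(1,2) True, of v] by simp
  next
    case False
    then show ?thesis using key[OF uv(2,1), of v] uv(3) by simp
  qed
  ultimately show ?thesis by simp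
qed

end

section \<open>Manneville--Pomeau maps\<close>

text \<open>
  The second claim is the quantitative convexity that makes up for the neutral fixed point: the
  derivative of \<open>y f' y - f y\<close> is \<open>y f'' y\<close>, which is at least \<open>y\<^sup>\<gamma> / C\<close>.
\<close>

lemma left_branch_estimates:
  fixes f L' L'' :: "real \<Rightarrow> real"
  assumes cont: "continuous_on {0..<r} f" "continuous_on {0..<r} L'"
    and df: "\<And>x. x \<in> {0<..<r} \<Longrightarrow> (f has_real_derivative L' x) (at x)"
    and dL': "\<And>x. x \<in> {0<..<r} \<Longrightarrow> (L' has_real_derivative L'' x) (at x)"
    and start: "f 0 = 0" "L' 0 = 1"
    and C: "1 \<le> C" "0 < \<gamma>"
    and lower: "\<And>x. x \<in> {0<..<r} \<Longrightarrow> x powr (\<gamma> - 1) \<le> C * L'' x"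
  shows left_branch_derivative_mono: "\<And>x y. 0 \<le> x \<Longrightarrow> x < y \<Longrightarrow> y < r \<Longrightarrow> L' x < L' y"
    and left_branch_convexity_gain:
      "\<And>y. y \<in> {0<..<r} \<Longrightarrow> y powr (\<gamma> + 1) \<le> C * (\<gamma> + 1) * (y * L' y - f y)"
proof -
  have pos: "0 < L'' x" if "x \<in> {0<..<r}" for x
  proof -
    have "0 < C * L'' x" using lower[OF that] that by (auto intro: less_le_trans[of _ "x powr (\<gamma> - 1)"])
    then show ?thesis using C by (simp add: zero_less_mult_iff)
  qed
  show "L' x < L' y" if xy: "0 \<le> x" "x < y" "y < r" for x y
  proof (rule DERIV_pos_imp_increasing_open[OF xy(2)])
    show "\<exists>d. (L' has_real_derivative d) (at t) \<and> 0 < d" if "x < t" "t < y" for t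
      using that xy dL'[of t] pos[of t] by auto
    show "continuous_on {x..y} L'" by (rule continuous_on_subset[OF cont(2)]) (use xy in auto)
  qed
  show "y powr (\<gamma> + 1) \<le> C * (\<gamma> + 1) * (y * L' y - f y)" if y: "y \<in> {0<..<r}" for y
  proof -
    define \<phi> where "\<phi> t = C * (\<gamma> + 1) * (t * L' t - f t) - t powr (\<gamma> + 1)" for t
    have "\<phi> 0 \<le> \<phi> y"
    proof (rule DERIV_nonneg_imp_increasing_open[of 0 y \<phi>])
      show "0 \<le> y" using y by simp
      show "\<exists>d. (\<phi> has_real_derivative d) (at t) \<and> 0 \<le> d" if t: "0 < t" "t < y" for t
      proof (intro exI conjI)
        have t': "t \<in> {0<..<r}" using t y by auto
        show "(\<phi> has_real_derivative
            C * (\<gamma> + 1) * (L' t + t * L'' t - L' t) - (\<gamma> + 1) * t powr (\<gamma> + 1 - 1)) (at t)"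
          unfolding \<phi>_def by (rule derivative_eq_intros df[OF t'] dL'[OF t'] refl | use t in simp)+
        have "t powr \<gamma> = t * t powr (\<gamma> - 1)" using t by (simp add: powr_diff)
        also have "\<dots> \<le> t * (C * L'' t)" using lower[OF t'] t by (intro mult_left_mono) auto
        finally have "(\<gamma> + 1) * t powr \<gamma> \<le> (\<gamma> + 1) * (t * (C * L'' t))"
          using C by (intro mult_left_mono) auto
        then show "0 \<le> C * (\<gamma> + 1) * (L' t + t * L'' t - L' t) - (\<gamma> + 1) * t powr (\<gamma> + 1 - 1)"
          by (simp add: mult_ac)
      qed
      have "{0..y} \<subseteq> {0..<r}" using y by auto
      note sub = continuous_on_subset[OF cont(1) this] continuous_on_subset[OF cont(2) this]
      show "continuous_on {0..y} \<phi>" unfolding \<phi>_def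
        using C by (intro continuous_intros continuous_on_powr' sub) auto
    qed
    then show ?thesis by (simp add: \<phi>_def start)
  qed
qed

text \<open>
  With \<open>F = f y\<close>, \<open>D = f' y\<close> and \<open>D2 = f'' y\<close>, the surplus density of \<open>g t = ln t + K t\<close> is at least
  \<open>D / F - 1 / y = (y D - F) / (y F)\<close>. By convexity the numerator is at least of order
  \<open>y\<^bsup>\<gamma>+1\<^esup>\<close>, and the denominator is at most \<open>M y\<^sup>2\<close>, which leaves \<open>y\<^bsup>\<gamma>-1\<^esup>\<close>, the order of \<open>f''\<close>.
\<close>

lemma neutral_branch_tempered:
  fixes y :: real
  assumes y: "0 < y" and F: "0 < F" and D: "1 \<le> D" "D \<le> M" and K: "0 \<le> K" and C: "1 \<le> C" "0 < \<gamma>"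
    and gain: "y powr (\<gamma> + 1) \<le> C * (\<gamma> + 1) * (y * D - F)"
    and upper: "\<bar>D2\<bar> \<le> C * y powr (\<gamma> - 1)"
  shows "\<bar>D2\<bar> \<le> C\<^sup>2 * (\<gamma> + 1) * M * (D * (1 / F + K) - (1 / y + K))"
proof -
  have k: "0 < C * (\<gamma> + 1)" using C by simp
  have "0 \<le> C * (\<gamma> + 1) * (y * D - F)" using gain by (rule order_trans[rotated]) simp
  then have diff: "0 \<le> y * D - F" using k by (simp add: zero_le_mult_iff)
  have "y * D \<le> y * M" using y D by simp
  then have FM: "F \<le> y * M" using diff by linarith
  have M: "1 \<le> M" using D by simp
  have "y powr (\<gamma> - 1) * (y * F) \<le> y powr (\<gamma> - 1) * (y * (y * M))"
    using FM y by (intro mult_left_mono) auto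
  also have "\<dots> = y powr (\<gamma> + 1) * M"
    using y by (simp add: powr_add powr_diff power2_eq_square field_simps)
  also have "\<dots> \<le> C * (\<gamma> + 1) * (y * D - F) * M"
    using gain M by (intro mult_right_mono) auto
  finally have "y powr (\<gamma> - 1) \<le> C * (\<gamma> + 1) * (y * D - F) * M / (y * F)"
    using y F by (simp add: pos_le_divide_eq)
  also have "\<dots> = C * (\<gamma> + 1) * M * (D / F - 1 / y)" using y F by (simp add: field_simps)
  also have "\<dots> \<le> C * (\<gamma> + 1) * M * (D * (1 / F + K) - (1 / y + K))"
  proof (rule mult_left_mono)
    have "1 * K \<le> D * K" using D(1) K by (rule mult_right_mono)
    then show "D / F - 1 / y \<le> D * (1 / F + K) - (1 / y + K)" by (simp add: algebra_simps)
    show "0 \<le> C * (\<gamma> + 1) * M" using k M by simp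
  qed
  finally have "C * y powr (\<gamma> - 1) \<le> C * (C * (\<gamma> + 1) * M * (D * (1 / F + K) - (1 / y + K)))"
    using C by (intro mult_left_mono) auto
  with upper show ?thesis by (simp add: power2_eq_square mult.assoc)
qed

text \<open>
  The logarithm alone does not suffice here, because \<open>1 / y\<close> can exceed \<open>\<bar>f' y\<bar> / f y\<close>. The linear
  term of \<open>g\<close> repairs this: \<open>K\<close> is chosen such that its gain \<open>K (\<theta> - 1)\<close> outweighs \<open>1 / r\<close> by 1.
\<close>

lemma hyperbolic_branch_tempered:
  fixes y :: real
  assumes r: "0 < r" "r \<le> y" and F: "0 < F" "F \<le> 1" and D: "\<theta> \<le> D" "1 < \<theta>"
    and K: "K = (1 / r + 1) / (\<theta> - 1)" and upper: "\<bar>D2\<bar> \<le> B"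
  shows "\<bar>D2\<bar> \<le> B * (D * (1 / F + K) - (1 / y + K))"
proof -
  have K0: "0 \<le> K" using r D by (simp add: K)
  have "K * (\<theta> - 1) = 1 / r + 1" using D by (simp add: K)
  moreover have "\<theta> * K \<le> D * K" using D K0 by (intro mult_right_mono) auto
  moreover have "0 \<le> D * (1 / F)" using D F by simp
  moreover have "1 / y \<le> 1 / r" using r by (simp add: frac_le)
  ultimately have "1 \<le> D * (1 / F + K) - (1 / y + K)" by (simp add: algebra_simps)
  moreover have "0 \<le> B" using upper by linarith
  ultimately have "B * 1 \<le> B * (D * (1 / F + K) - (1 / y + K))" by (intro mult_left_mono)
  with upper show ?thesis by simp
qed

lemma derivative_off_point:
  assumes "(f(r := c) has_real_derivative D) (at x within S)" "open T" "x \<in> T" "T \<subseteq> S" "r \<notin> T"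
  shows "(f has_real_derivative D) (at x)"
proof -
  have "x \<in> interior S" using assms(2-4) by (rule interiorI)
  then have "(f(r := c) has_real_derivative D) (at x)"
    using assms(1) by (simp only: at_within_interior)
  then show ?thesis
  proof (rule has_field_derivative_transform_within_open)
    show "(f(r := c)) t = f t" if "t \<in> T" for t using that assms(5) by auto
  qed (use assms in blast)+
qed

text \<open>
  In \<open>g t = ln t + K t\<close> the logarithm accounts for the branch with the neutral fixed point, and the
  linear term, harmless there, for the other branch.
\<close>

lemma manneville_pomeau_full_branch_map:
  assumes "manneville_pomeau f"
  shows "\<exists>r l g A. full_branch_map f r l g A"
proof -
  obtain r L' L'' R' R'' C \<gamma> where r: "r \<in> {0<..<1}"
    and onto: "f ` {0<..<r} = {0<..<1}" "f ` {r<..<1} = {0<..<1}"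
    and dL: "\<And>x. x \<in> {0..r} \<Longrightarrow> (left_branch f r has_real_derivative L' x) (at x within {0..r})"
    and dR: "\<And>x. x \<in> {r..1} \<Longrightarrow> (right_branch f r has_real_derivative R' x) (at x within {r..1})"
    and cL': "continuous_on {0..<r} L'"
    and dL': "\<And>x. x \<in> {0<..<r} \<Longrightarrow> (L' has_real_derivative L'' x) (at x)"
    and dR': "\<And>x. x \<in> {r<..1} \<Longrightarrow> (R' has_real_derivative R'' x) (at x within {r<..1})"
    and start: "f 0 = 0" "L' 0 = 1"
    and R'1: "\<And>x. x \<in> {r..1} \<Longrightarrow> \<bar>R' x\<bar> > 1"
    and bL': "bdd_above ((\<lambda>x. \<bar>L' x\<bar>) ` {0..r})"
    and bR'': "bdd_above ((\<lambda>x. \<bar>R'' x\<bar>) ` {r<..1})"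
    and C: "C \<ge> 1" "\<gamma> > 0"
    and L'': "\<And>x. x \<in> {0<..<r} \<Longrightarrow>
        inverse C \<le> L'' x / x powr (\<gamma> - 1) \<and> L'' x / x powr (\<gamma> - 1) \<le> C"
    using assms unfolding manneville_pomeau_def
    by (elim conjE bexE exE) (rule that; (assumption | erule (1) bspec))
  have r01: "0 < r" "r < 1" using r by auto
  obtain M where "\<forall>d\<in>(\<lambda>x. \<bar>L' x\<bar>) ` {0..r}. d \<le> M" using bL' unfolding bdd_above_def by blast
  then have M: "\<bar>L' x\<bar> \<le> M" if "x \<in> {0..r}" for x using that by blast
  obtain B where "\<forall>d\<in>(\<lambda>x. \<bar>R'' x\<bar>) ` {r<..1}. d \<le> B" using bR'' unfolding bdd_above_def by blast
  then have B: "\<bar>R'' x\<bar> \<le> B" if "x \<in> {r<..1}" for x using that by blast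
  have df_left: "(f has_real_derivative L' x) (at x)" if "x \<in> {0<..<r}" for x
    by (rule derivative_off_point[OF dL[unfolded left_branch_def], of x "{0<..<r}"]) (use that in auto)
  have df_right: "(f has_real_derivative R' x) (at x)" if "x \<in> {r<..<1}" for x
    by (rule derivative_off_point[OF dR[unfolded right_branch_def], of x "{r<..<1}"]) (use that in auto)
  have dR'_at: "(R' has_real_derivative R'' x) (at x)" if "x \<in> {r<..<1}" for x
  proof -
    have "at x within {r<..1} = at x"
      using that by (intro at_within_interior) (auto intro!: interiorI[of "{r<..<1}"])
    then show ?thesis using dR'[of x] that by auto
  qed
  have "continuous_on {0..r} (left_branch f r)"
    using dL by (intro DERIV_continuous_on)
  then have "continuous_on {0..<r} (left_branch f r)" by (rule continuous_on_subset) auto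
  then have cont_f: "continuous_on {0..<r} f"
    by (rule continuous_on_eq) (auto simp: left_branch_def)
  have L''_lower: "x powr (\<gamma> - 1) \<le> C * L'' x" and L''_upper: "\<bar>L'' x\<bar> \<le> C * x powr (\<gamma> - 1)"
    if x: "x \<in> {0<..<r}" for x
  proof -
    have p: "0 < x powr (\<gamma> - 1)" using x by simp
    show lo: "x powr (\<gamma> - 1) \<le> C * L'' x"
      using L''[OF x] p C by (simp add: pos_le_divide_eq field_simps)
    have "0 < C * L'' x" using p lo by (rule less_le_trans)
    then have "0 < L'' x" using C by (simp add: zero_less_mult_iff)
    then show "\<bar>L'' x\<bar> \<le> C * x powr (\<gamma> - 1)"
      using L''[OF x] p by (simp add: pos_divide_le_eq)
  qed
  have L'_mono: "L' x < L' y" if "0 \<le> x" "x < y" "y < r" for x y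
    by (rule left_branch_derivative_mono[OF cont_f cL' df_left dL' start C L''_lower that])
  have gain: "y powr (\<gamma> + 1) \<le> C * (\<gamma> + 1) * (y * L' y - f y)" if "y \<in> {0<..<r}" for y
    by (rule left_branch_convexity_gain[OF cont_f cL' df_left dL' start C L''_lower that])
  have L'1: "1 < L' x" if "x \<in> {0<..<r}" for x using L'_mono[of 0 x] start that by auto
  have R'_cont: "continuous_on {r..1} R'"
    by (rule derivative_continuous_at_left_end[OF r01(2) dR dR' B])
  obtain s where s: "s \<in> {1, -1}" "\<And>x. x \<in> {r..1} \<Longrightarrow> 0 < s * R' x"
  proof -
    have "R' x \<noteq> 0" if "x \<in> {r..1}" for x using R'1[OF that] by auto
    then show ?thesis using continuous_nonzero_constant_sign[OF R'_cont] that by blast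
  qed
  have "\<exists>x\<in>{r..1}. \<forall>y\<in>{r..1}. \<bar>R' x\<bar> \<le> \<bar>R' y\<bar>"
    using R'_cont r01 by (intro continuous_attains_inf continuous_intros) auto
  then obtain \<theta> where \<theta>: "1 < \<theta>" "\<And>x. x \<in> {r..1} \<Longrightarrow> \<theta> \<le> \<bar>R' x\<bar>"
    using R'1 by blast
  interpret left: expanding_branch f L' 0 r 1
    by unfold_locales (use df_left L'1 in \<open>auto simp: less_imp_le\<close>)
  interpret right: expanding_branch f R' r 1 s
  proof
    show "1 \<le> s * R' x" if "x \<in> {r<..<1}" for x
    proof -
      have "x \<in> {r..1}" using that by simp
      then have "0 < s * R' x" "1 < \<bar>R' x\<bar>" using s(2) R'1 by blast+
      then show ?thesis using s(1) by auto
    qed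
  qed (use df_right s in auto)
  define K where "K = (1 / r + 1) / (\<theta> - 1)"
  have K: "0 \<le> K" using \<theta>(1) r01 by (simp add: K_def)
  define g where "g t = ln t + K * t" for t :: real
  define w where "w t = 1 / t + K" for t :: real
  have dg: "(g has_real_derivative w y) (at y)" if "y \<in> {0<..<1}" for y
    unfolding g_def w_def using that by (auto intro!: derivative_eq_intros)
  have g_mono: "mono_on {0<..1} g"
    unfolding g_def mono_on_def using K by (auto intro!: add_mono mult_left_mono)
  define l where "l x = ln \<bar>if x < r then L' x else R' x\<bar>" for x
  define A where "A = max (C\<^sup>2 * (\<gamma> + 1) * M) (max B 0)"
  have "full_branch_map f r l g A"
  proof
    show "0 < r" "r < 1" "f ` {0<..<r} = {0<..<1}" "f ` {r<..<1} = {0<..<1}" "mono_on {0<..1} g" "0 \<le> A"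
      using r01 onto g_mono by (auto simp: A_def)
  next
    show "f w \<in> closed_segment (f u) (f v)" if "same_branch r u v" "w \<in> closed_segment u v" for u v w
      using that left.between right.between unfolding same_branch_def by blast
  next
    show "\<bar>u - v\<bar> \<le> \<bar>f u - f v\<bar>" if "same_branch r u v" for u v
    proof -
      have "1 * \<bar>u - v\<bar> \<le> \<bar>f u - f v\<bar>" using that unfolding same_branch_def
      proof (elim disjE conjE)
        assume uv: "u \<in> {0<..<r}" "v \<in> {0<..<r}"
        show ?thesis by (rule left.expand_abs[OF uv]) (use left.abs_F' left.expanding in simp)
      next
        assume uv: "u \<in> {r<..<1}" "v \<in> {r<..<1}"
        show ?thesis by (rule right.expand_abs[OF uv]) (simp add: right.abs_F' right.expanding)
      qed
      then show ?thesis by simp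
    qed
  next
    fix \<kappa> :: real assume \<kappa>: "0 < \<kappa>"
    \<comment> \<open>Two points of the left branch at distance at least \<open>\<kappa>\<close> have their midpoint beyond \<open>\<kappa> / 2\<close>,
      and to the right of it the slope is at least \<open>L' (\<kappa> / 2)\<close>. If \<open>r \<le> \<kappa> / 2\<close>, there are no such
      points and 2 is an arbitrary value.\<close>
    define \<sigma> where "\<sigma> = (if \<kappa> / 2 < r then (1 + L' (\<kappa> / 2)) / 2 else 2)"
    have \<sigma>: "1 < \<sigma>" using L'1[of "\<kappa> / 2"] \<kappa> by (auto simp: \<sigma>_def)
    have left_gain: "\<sigma> * (v - u) \<le> \<bar>f v - f u\<bar>"
      if uv: "u \<in> {0<..<r}" "v \<in> {0<..<r}" "\<kappa> \<le> v - u" for u v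
    proof -
      define m where "m = (u + v) / 2"
      have m: "u < m" "m < v" "m \<in> {0<..<r}" "\<kappa> / 2 < m" "\<kappa> / 2 < r"
        using uv \<kappa> by (auto simp: m_def)
      have "1 * (m - u) \<le> 1 * (f m - f u)"
        by (rule left.expand_by) (use uv m L'1 in \<open>auto simp: less_imp_le intro!: order_trans[OF _ abs_ge_self]\<close>)
      moreover have "L' (\<kappa> / 2) * (v - m) \<le> 1 * (f v - f m)"
      proof (rule left.expand_by)
        fix z assume "z \<in> {m<..<v}"
        then have "L' (\<kappa> / 2) < L' z" using m uv \<kappa> by (intro L'_mono) auto
        then show "L' (\<kappa> / 2) \<le> \<bar>L' z\<bar>" by simp
      qed (use uv m in auto)
      moreover have "\<sigma> * (v - u) = 1 * (m - u) + L' (\<kappa> / 2) * (v - m)"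
        using m(5) by (simp add: \<sigma>_def m_def field_simps)
      ultimately show ?thesis by simp
    qed
    show "\<exists>\<mu>>1. \<forall>u v. same_branch r u v \<and> \<kappa> \<le> \<bar>u - v\<bar> \<longrightarrow> \<mu> * \<bar>u - v\<bar> \<le> \<bar>f u - f v\<bar>"
    proof (intro exI[of _ "min \<sigma> \<theta>"] conjI allI impI)
      show "1 < min \<sigma> \<theta>" using \<sigma> \<theta> by simp
      fix u v assume uv: "same_branch r u v \<and> \<kappa> \<le> \<bar>u - v\<bar>"
      show "min \<sigma> \<theta> * \<bar>u - v\<bar> \<le> \<bar>f u - f v\<bar>"
      proof (cases "u \<in> {0<..<r}")
        case True
        then have v: "v \<in> {0<..<r}" using uv by (auto simp: same_branch_def)
        have "min \<sigma> \<theta> * \<bar>u - v\<bar> \<le> \<sigma> * \<bar>u - v\<bar>" by (intro mult_right_mono) auto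
        also have "\<dots> \<le> \<bar>f u - f v\<bar>"
          using left_gain[OF True v] left_gain[OF v True] uv
          by (cases "u \<le> v") (simp_all add: abs_minus_commute)
        finally show ?thesis .
      next
        case False
        then have uv': "u \<in> {r<..<1}" "v \<in> {r<..<1}" using uv by (auto simp: same_branch_def)
        have "min \<sigma> \<theta> * \<bar>u - v\<bar> \<le> \<theta> * \<bar>u - v\<bar>" by (intro mult_right_mono) auto
        also have "\<dots> \<le> \<bar>f u - f v\<bar>" by (rule right.expand_abs[OF uv']) (use \<theta> in auto)
        finally show ?thesis .
      qed
    qed
  next
    fix u v assume sb: "same_branch r u v" and ne: "u \<noteq> v"
    have enlarge: "\<bar>x\<bar> \<le> A * y" if "\<bar>x\<bar> \<le> c * y" "c \<le> A" "0 < c" for x y c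
    proof -
      have "0 \<le> c * y" using that(1) by linarith
      then have "0 \<le> y" using that(3) by (simp add: zero_le_mult_iff)
      then have "c * y \<le> A * y" using that(2) by (rule mult_right_mono[rotated])
      then show ?thesis using that(1) by linarith
    qed
    show "\<bar>ln \<bar>f u - f v\<bar> - ln \<bar>u - v\<bar> - l v\<bar> \<le> A * (\<bar>g (f u) - g (f v)\<bar> - \<bar>g u - g v\<bar>)"
    proof (cases "u \<in> {0<..<r}")
      case True
      then have v: "v \<in> {0<..<r}" using sb by (auto simp: same_branch_def)
      have "1 < M" using L'1[OF v] M[of v] v by auto
      have "\<bar>ln \<bar>f u - f v\<bar> - ln \<bar>u - v\<bar> - ln \<bar>L' v\<bar>\<bar>
          \<le> C\<^sup>2 * (\<gamma> + 1) * M * (\<bar>g (f u) - g (f v)\<bar> - \<bar>g u - g v\<bar>)"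
      proof (rule left.tempered_distortion[OF _ _ dL' dg g_mono _ True v ne])
        show "f x \<in> {0<..<1}" if "x \<in> {0<..<r}" for x using onto that by blast
        show "\<bar>L'' x\<bar> \<le> C\<^sup>2 * (\<gamma> + 1) * M * (\<bar>L' x\<bar> * w (f x) - w x)" if x: "x \<in> {0<..<r}" for x
          unfolding w_def
        proof (rule neutral_branch_tempered[OF _ _ _ _ K C _ L''_upper[OF x]])
          show "0 < f x" using onto x by force
          show "1 \<le> \<bar>L' x\<bar>" "\<bar>L' x\<bar> \<le> M" using L'1[OF x] M[of x] x by auto
          show "x powr (\<gamma> + 1) \<le> C * (\<gamma> + 1) * (x * \<bar>L' x\<bar> - f x)"
            using gain[OF x] L'1[OF x] by simp
        qed (use x in auto)
      qed (use r01 in auto)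
      moreover have "l v = ln \<bar>L' v\<bar>" using v by (simp add: l_def)
      moreover have "0 < C\<^sup>2 * (\<gamma> + 1) * M" using C \<open>1 < M\<close> by simp
      ultimately show ?thesis by (intro enlarge[of _ "C\<^sup>2 * (\<gamma> + 1) * M"]) (auto simp: A_def)
    next
      case False
      then have uv: "u \<in> {r<..<1}" "v \<in> {r<..<1}" using sb by (auto simp: same_branch_def)
      have "\<bar>ln \<bar>f u - f v\<bar> - ln \<bar>u - v\<bar> - ln \<bar>R' v\<bar>\<bar>
          \<le> A * (\<bar>g (f u) - g (f v)\<bar> - \<bar>g u - g v\<bar>)"
      proof (rule right.tempered_distortion[OF _ _ dR'_at dg g_mono _ uv ne])
        show "f x \<in> {0<..<1}" if "x \<in> {r<..<1}" for x using onto that by blast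
        show "\<bar>R'' x\<bar> \<le> A * (\<bar>R' x\<bar> * w (f x) - w x)" if x: "x \<in> {r<..<1}" for x
          unfolding w_def
        proof (rule hyperbolic_branch_tempered[OF r01(1) _ _ _ _ \<theta>(1) K_def])
          have "f x \<in> {0<..<1}" using onto x by blast
          then show "0 < f x" "f x \<le> 1" by auto
          show "\<theta> \<le> \<bar>R' x\<bar>" using \<theta>(2) x by auto
          show "\<bar>R'' x\<bar> \<le> A" using B[of x] x by (auto simp: A_def)
        qed (use x in auto)
      qed (use r01 in auto)
      then show ?thesis using uv by (simp add: l_def)
    qed
  qed
  then show ?thesis by blast
qed

theorem theorem1p2:
  fixes f :: "real \<Rightarrow> real" and P :: "real set"
  assumes "manneville_pomeau f" and "countable P" and "P \<subseteq> {0..1}"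
  shows "absolute_winning {0..1} (exceptional_set f P)"
proof -
  obtain r l g A where "full_branch_map f r l g A"
    using manneville_pomeau_full_branch_map[OF assms(1)] by blast
  then show ?thesis
    using assms by (intro full_branch_map.absolute_winning_exceptional_set)
      (auto simp: manneville_pomeau_def)
qed

end
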